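(* Let $f\in\mathcal A_c$ with primitive $F\in\mathcal B_c$. Then: (a) For each $x\in\mathbb R$ and $t>0$ the integrals $f\ast\Theta_t(x)$, $\Theta_t\ast f(x)$ and $F\ast\Theta_t'(x)=\int_{-\infty}^\infty F(\xi)\Theta_t'(x-\xi)\,d\xi$ exist, and $f\ast\Theta_t(x)=\Theta_t\ast f(x)=F\ast\Theta_t'(x)=[F\ast\Theta_t]'(x)$ (derivative in $x$). (b) $(x,t)\mapsto f\ast\Theta_t(x)$ is $C^\infty$ on $\mathbb R\times(0,\infty)$. (c) For every $t>0$, $\|f\ast\Theta_t\|_\infty\le \|f\|/(2\sqrt{\pi t})$, and this estimate is sharp in the sense that the coefficient $1/(2\sqrt{\pi t})$ of $\|f\|$ cannot be reduced. (d) For $t>0$ define the linear operator $\Phi_t:\mathcal A_c\to C(\overline{\mathbb R})$ by $\Phi_t(g)=g\ast\Theta_t$ (with $\mathcal A_c$ normed by the Alexiewicz norm and $C(\overline{\mathbb R})$ by the supremum norm). Then $\|\Phi_t\|=1/(2\sqrt{\pi t})$. (e) For each $t>0$, $\lim_{|x|\to\infty}f\ast\Theta_t(x)=0$. (f) For each $t>0$, $f\ast\Theta_t\in\mathcal A_c$ and $\|f\ast\Theta_t\|\le\|f\|$, and this inequality is sharp in the sense that the coefficient of $\|f\|$ cannot be reduced. The linear operator $\Psi_t:\mathcal A_c\to\mathcal A_c$, $\Psi_t(g)=g\ast\Theta_t$, has operator norm $\|\Psi_t\|=1$. (g) Let $u(x,t)=f\ast\Theta_t(x)$. Then $u$ is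 twice continuously differentiable in $x$ and continuously differentiable in $t$ on $\mathbb R\times(0,\infty)$, satisfies $\partial_t u-\partial_x^2u=0$ on $\mathbb R\times(0,\infty)$, and $\|u(\cdot,t)-f\|\to0$ as $t\to0^+$. (h) For each $t>0$, $\int_{-\infty}^\infty f\ast\Theta_t=\int_{-\infty}^\infty f$. (i) The convolution need not lie in any $L^p$ space: for each $t>0$ there exists $g\in\mathcal A_c$ such that $g\ast\Theta_t\notin L^p(\mathbb R)$ for every $1\le p<\infty$. (j) For each $t>0$, $x\mapsto f\ast\Theta_t(x)$ is real analytic on $\mathbb R$; for each $x\in\mathbb R$, $t\mapsto f\ast\Theta_t(x)$ is real analytic on $(0,\infty)$.
   Context: Let $\overline{\mathbb R}=[-\infty,\infty]$ and let $C(\overline{\mathbb R})$ be the continuous functions $F:\mathbb R\to\mathbb R$ for which $F(\pm\infty):=\lim_{x\to\pm\infty}F(x)$ exist as real numbers. Let $\mathcal B_c=\{F\in C(\overline{\mathbb R}): F(-\infty)=0\}$. Let $\mathcal A_c$ be the set of Schwartz distributions $f$ on $\mathbb R$ such that $f=F'$ (distributional derivative) for some $F\in\mathcal B_c$; this $F$ is unique and called the primitive of $f$. The continuous primitive integral is $\int_a^b f=F(b)-F(a)$ for $a,b\in\overline{\mathbb R}$, and the Alexiewicz norm is $\|f\|=\sup_{x<y}|F(y)-F(x)|$. Locally (Lebesgue or Henstock–Kurzweil) integrable functions are identified with distributions; a function lies in $\mathcal A_c$ when it is the distributional derivative of an element of $\mathcal B_c$. For $g:\mathbb R\to\mathbb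 R$ of bounded variation (variation $Vg=\sup\sum_i|g(x_i)-g(y_i)|$ over disjoint intervals $(x_i,y_i)\subset\mathbb R$, limits $g(\pm\infty)$), $\int_{-\infty}^\infty fg:=F(\infty)g(\infty)-\int_{-\infty}^\infty F\,dg$ (Henstock–Stieltjes integral). Accordingly the convolution $f\ast g(x)=\int_{-\infty}^\infty f(\xi)g(x-\xi)\,d\xi$ and $g\ast f(x)=\int_{-\infty}^\infty f(x-\xi)g(\xi)\,d\xi$ are defined in this sense. The heat kernel is $\Theta_t(x)=(4\pi t)^{-1/2}e^{-x^2/(4t)}$ for $t>0$, primes denoting $x$-derivatives. $\|\cdot\|_\infty$ is the supremum norm on $\mathbb R$. *)

theory Defs
  imports "HOL-Analysis.Analysis"
begin

definition heat_kernel :: "real \<Rightarrow> real \<Rightarrow> real" where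
  "heat_kernel t x = exp (- (x^2) / (4 * t)) / sqrt (4 * pi * t)"

definition at_pinf :: "(real \<Rightarrow> real) \<Rightarrow> real" where
  "at_pinf F = Lim at_top F"
definition at_minf :: "(real \<Rightarrow> real) \<Rightarrow> real" where
  "at_minf F = Lim at_bot F"

definition Cbar :: "(real \<Rightarrow> real) set" where
  "Cbar = {F. continuous_on UNIV F \<and> (\<exists>l. (F \<longlongrightarrow> l) at_top) \<and> (\<exists>l. (F \<longlongrightarrow> l) at_bot)}"

text \<open>B_c: elements of Cbar vanishing at minus infinity.  An element f of A_c
  (a distribution) is represented throughout by its (unique) primitive F in B_c.\<close>
definition Bc :: "(real \<Rightarrow> real) set" where
  "Bc = {F \<in> Cbar. (F \<longlongrightarrow> 0) at_bot}"

text \<open>Alexiewicz norm of the distribution whose primitive is F.\<close>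
definition alex :: "(real \<Rightarrow> real) \<Rightarrow> real" where
  "alex F = Sup {\<bar>F y - F x\<bar> | x y. x < y}"

text \<open>Continuous primitive integral over the whole line, int_{-oo}^{oo} f = F(oo) - F(-oo).\<close>
definition cp_integral_R :: "(real \<Rightarrow> real) \<Rightarrow> real" where
  "cp_integral_R F = at_pinf F - at_minf F"

text \<open>A (locally Henstock-Kurzweil integrable) function u lies in A_c iff it is the
  distributional derivative of some G in B_c, i.e. u integrates to G b - G a on [a,b].\<close>
definition is_prim_of :: "(real \<Rightarrow> real) \<Rightarrow> (real \<Rightarrow> real) \<Rightarrow> bool" where
  "is_prim_of G u \<longleftrightarrow> G \<in> Bc \<and> (\<forall>a b. a \<le> b \<longrightarrow> (u has_integral (G b - G a)) {a..b})"

definition fun_in_Ac :: "(real \<Rightarrow> real) \<Rightarrow> bool" where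
  "fun_in_Ac u \<longleftrightarrow> (\<exists>G. is_prim_of G u)"

definition Ac_prim :: "(real \<Rightarrow> real) \<Rightarrow> (real \<Rightarrow> real)" where
  "Ac_prim u = (THE G. is_prim_of G u)"

definition sup_norm :: "(real \<Rightarrow> real) \<Rightarrow> real" where
  "sup_norm u = Sup (range (\<lambda>x. \<bar>u x\<bar>))"

definition hs_has_integral_on ::
    "(real \<Rightarrow> real) \<Rightarrow> (real \<Rightarrow> real) \<Rightarrow> real \<Rightarrow> real \<Rightarrow> real \<Rightarrow> bool" where
  "hs_has_integral_on F g I a b \<longleftrightarrow>
     (\<forall>e>0. \<exists>\<gamma>. gauge \<gamma> \<and>
        (\<forall>p. p tagged_division_of {a..b} \<and> \<gamma> fine p \<longrightarrow>
           \<bar>(\<Sum>(x,K)\<in>p. F x * (g (Sup K) - g (Inf K))) - I\<bar> < e))"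

definition hs_integral_on :: "(real \<Rightarrow> real) \<Rightarrow> (real \<Rightarrow> real) \<Rightarrow> real \<Rightarrow> real \<Rightarrow> real" where
  "hs_integral_on F g a b = (THE I. hs_has_integral_on F g I a b)"

definition hs_has_integral_R :: "(real \<Rightarrow> real) \<Rightarrow> (real \<Rightarrow> real) \<Rightarrow> real \<Rightarrow> bool" where
  "hs_has_integral_R F g I \<longleftrightarrow>
     (\<forall>a b. a \<le> b \<longrightarrow> (\<exists>J. hs_has_integral_on F g J a b)) \<and>
     ((\<lambda>(a,b). hs_integral_on F g a b) \<longlongrightarrow> I) (at_bot \<times>\<^sub>F at_top)"

definition hs_integrable_R :: "(real \<Rightarrow> real) \<Rightarrow> (real \<Rightarrow> real) \<Rightarrow> bool" where
  "hs_integrable_R F g \<longleftrightarrow> (\<exists>I. hs_has_integral_R F g I)"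

definition hs_integral_R :: "(real \<Rightarrow> real) \<Rightarrow> (real \<Rightarrow> real) \<Rightarrow> real" where
  "hs_integral_R F g = (THE I. hs_has_integral_R F g I)"

text \<open>Pairing int_{-oo}^{oo} f g := F(oo) g(oo) - int F dg for f in A_c with primitive F
  and g of bounded variation.\<close>
definition ac_pair :: "(real \<Rightarrow> real) \<Rightarrow> (real \<Rightarrow> real) \<Rightarrow> real" where
  "ac_pair F g = at_pinf F * at_pinf g - hs_integral_R F g"

definition conv_heat :: "(real \<Rightarrow> real) \<Rightarrow> real \<Rightarrow> real \<Rightarrow> real" where
  "conv_heat F t x = ac_pair F (\<lambda>\<xi>. heat_kernel t (x - \<xi>))"

text \<open>The distribution xi |-> f(x - xi) has primitive xi |-> F(oo) - F(x - xi).\<close>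
definition refl_prim :: "(real \<Rightarrow> real) \<Rightarrow> real \<Rightarrow> real \<Rightarrow> real" where
  "refl_prim F x = (\<lambda>\<xi>. at_pinf F - F (x - \<xi>))"

definition heat_conv :: "(real \<Rightarrow> real) \<Rightarrow> real \<Rightarrow> real \<Rightarrow> real" where
  "heat_conv F t x = ac_pair (refl_prim F x) (heat_kernel t)"

definition heat_u :: "(real \<Rightarrow> real) \<Rightarrow> real \<times> real \<Rightarrow> real" where
  "heat_u F = (\<lambda>(x,t). conv_heat F t x)"

definition pd_x :: "(real \<times> real \<Rightarrow> real) \<Rightarrow> real \<times> real \<Rightarrow> real" where
  "pd_x f = (\<lambda>(x,t). deriv (\<lambda>y. f (y,t)) x)"
definition pd_t :: "(real \<times> real \<Rightarrow> real) \<Rightarrow> real \<times> real \<Rightarrow> real" where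
  "pd_t f = (\<lambda>(x,t). deriv (\<lambda>s. f (x,s)) t)"

fun iter_pd :: "bool list \<Rightarrow> (real \<times> real \<Rightarrow> real) \<Rightarrow> real \<times> real \<Rightarrow> real" where
  "iter_pd [] f = f"
| "iter_pd (b # bs) f = (if b then pd_x else pd_t) (iter_pd bs f)"

definition C_infinity_on :: "(real \<times> real) set \<Rightarrow> (real \<times> real \<Rightarrow> real) \<Rightarrow> bool" where
  "C_infinity_on S f \<longleftrightarrow>
     (\<forall>bs. continuous_on S (iter_pd bs f) \<and>
        (\<forall>(x,t)\<in>S. (\<lambda>y. iter_pd bs f (y,t)) differentiable (at x) \<and>
                    (\<lambda>s. iter_pd bs f (x,s)) differentiable (at t)))"

definition real_analytic_on :: "real set \<Rightarrow> (real \<Rightarrow> real) \<Rightarrow> bool" where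
  "real_analytic_on S f \<longleftrightarrow>
     (\<forall>x0\<in>S. \<exists>r>0. \<exists>a::nat \<Rightarrow> real. \<forall>y. \<bar>y - x0\<bar> < r \<longrightarrow> (\<lambda>n. a n * (y - x0)^n) sums f y)"

end

theory Submission
  imports
    Defs
    "HOL-Probability.Characteristic_Functions"
    "HOL-Complex_Analysis.Cauchy_Integral_Formula"
    "HOL-Real_Asymp.Real_Asymp"
begin

text \<open>
  Integration by parts turns \<open>f * \<Theta>\<^sub>t\<close> into \<open>F * \<Theta>\<^sub>t'\<close>, an absolutely convergent integral of the
  bounded continuous primitive \<open>F\<close> against a first Gaussian moment. After the substitution
  \<open>\<xi> = x - \<surd>t w\<close> the kernel no longer depends on \<open>x\<close> and \<open>t\<close>, so dominated convergence gives
  all limits and the joint continuity. Since \<open>\<integral>\<Theta>\<^sub>t' = 0\<close>, \<open>F\<close> may be replaced by \<open>F - m\<close> with \<open>m\<close> the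
  midrange of \<open>F\<close>, which yields the sharp constant; ramps approximating the Heaviside function
  attain it in the limit. Letting \<open>x\<close> or \<open>t\<close> be complex makes the integrals holomorphic, whence the
  derivatives and the analyticity. The function \<open>f * \<Theta>\<^sub>t\<close> has primitive \<open>F * \<Theta>\<^sub>t\<close>, which converges
  uniformly to \<open>F\<close> because \<open>F\<close> is uniformly continuous. Finally, the primitive
  \<open>cos x / (1 + ln (1 + \<bar>x\<bar>))\<close> has a convolution asymptotic to \<open>- exp (- t) sin x / (1 + ln (1 + \<bar>x\<bar>))\<close>,
  which decays too slowly for any \<open>L\<^sup>p\<close>.
\<close>

section \<open>Differentiation under the integral sign\<close>

text \<open>The convolutions and primitives are defined through gauge integrals, \<open>Lim\<close>
  and \<open>THE\<close>, so they must first be identified with Lebesgue integrals of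
  \<open>F\<close> against a polynomial times the kernel. These moments, with coefficients in powers
  of \<open>1 / t\<close>, are closed under both partial derivatives, which makes smoothness and the
  heat equation a matter of algebra. Complex variables are convenient because Cauchy's inequality
  bounds a derivative by the function itself: one majorant of the complexified kernel justifies
  differentiation under the integral and yields the power series too. Most estimates are stated for
  bounded continuous \<open>F\<close> without limits at infinity, since the final counterexample is
  compared with the exact evolution of \<open>cos\<close>. Its amplitude is logarithmic because a
  negative power of \<open>\<bar>x\<bar>\<close> would be p-th power integrable at infinity for
  large \<open>p\<close>.\<close>

lemma has_field_derivative_integral_dominated_center:
  fixes f f' :: "complex \<Rightarrow> 'a \<Rightarrow> complex" and g :: "'a \<Rightarrow> real"
  assumes r: "r > 0"
    and der: "\<And>z y. z \<in> ball z0 r \<Longrightarrow> ((\<lambda>z. f z y) has_field_derivative f' z y) (at z)"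
    and meas: "\<And>z. z \<in> ball z0 r \<Longrightarrow> f z \<in> borel_measurable M"
    and bound: "\<And>z y. z \<in> ball z0 r \<Longrightarrow> norm (f z y) \<le> g y"
    and g: "integrable M g"
  shows "((\<lambda>z. integral\<^sup>L M (f z)) has_field_derivative integral\<^sup>L M (f' z0)) (at z0)"
proof -
  define s where "s = r / 2"
  have s: "s > 0" using r by (simp add: s_def)
  have int: "integrable M (f z)" if "z \<in> ball z0 r" for z
    using g meas[OF that] by (rule Bochner_Integration.integrable_bound)
      (use bound[OF that] in \<open>auto intro!: AE_I2 order_trans[OF bound[OF that]]\<close>)
  \<comment> \<open>Only \<open>f\<close> is dominated by hypothesis, not \<open>f'\<close>. The
    disc of radius \<open>s / 2\<close> about \<open>z\<close> stays inside
    \<open>ball z0 r\<close>, so Cauchy's inequality with \<open>g y\<close> on its boundary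
    controls \<open>f'\<close>.\<close>
  have f'bound: "norm (f' z y) \<le> g y / (s / 2)" if z: "z \<in> ball z0 s" for z y
  proof -
    have sub: "cball z (s / 2) \<subseteq> ball z0 r"
    proof
      fix w assume "w \<in> cball z (s / 2)"
      then show "w \<in> ball z0 r" using z s dist_triangle[of z0 w z]
        by (simp add: s_def)
    qed
    have hol: "(\<lambda>z. f z y) holomorphic_on ball z0 r"
      unfolding holomorphic_on_open[OF open_ball] using der by blast
    have "norm ((deriv ^^ 1) (\<lambda>z. f z y) z) \<le> fact 1 * g y / (s / 2) ^ 1"
    proof (rule Cauchy_inequality)
      show "(\<lambda>z. f z y) holomorphic_on ball z (s / 2)"
        by (rule holomorphic_on_subset[OF hol]) (use sub in auto)
      show "continuous_on (cball z (s / 2)) (\<lambda>z. f z y)"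
        by (rule holomorphic_on_imp_continuous_on[OF holomorphic_on_subset[OF hol sub]])
      show "norm (f x y) \<le> g y" if "norm (z - x) = s / 2" for x
        by (rule bound, rule subsetD[OF sub]) (use that in \<open>simp add: dist_norm\<close>)
    qed (use s in simp)
    moreover have "deriv (\<lambda>z. f z y) z = f' z y"
      by (rule DERIV_imp_deriv, rule der) (use z s in \<open>auto simp: s_def\<close>)
    ultimately show ?thesis by simp
  qed
  \<comment> \<open>The mean value inequality on a convex disc gives a majorant of the difference
    quotients that does not depend on \<open>z\<close>.\<close>
  have quot: "norm ((f z y - f z0 y) / (z - z0)) \<le> g y / (s / 2)" if z: "z \<in> ball z0 s" "z \<noteq> z0" for z y
  proof -
    have "norm (f z y - f z0 y) \<le> g y / (s / 2) * norm (z - z0)"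
    proof (rule field_differentiable_bound[where S = "ball z0 s" and f = "\<lambda>z. f z y" and f' = "\<lambda>z. f' z y"])
      show "((\<lambda>z. f z y) has_field_derivative f' w y) (at w within ball z0 s)" if "w \<in> ball z0 s" for w
        by (rule has_field_derivative_at_within, rule der) (use that s in \<open>auto simp: s_def\<close>)
    qed (use f'bound z s in auto)
    then show ?thesis using z by (simp add: norm_divide divide_le_eq)
  qed
  have "((\<lambda>z. (integral\<^sup>L M (f z) - integral\<^sup>L M (f z0)) / (z - z0)) \<longlongrightarrow> integral\<^sup>L M (f' z0)) (at z0)"
    unfolding tendsto_at_iff_sequentially comp_def
  proof (intro allI impI)
    fix X :: "nat \<Rightarrow> complex" assume X: "\<forall>i. X i \<in> UNIV - {z0}" "X \<longlonglongrightarrow> z0"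
    from X(2) s have "eventually (\<lambda>n. X n \<in> ball z0 s) sequentially"
      by (intro topological_tendstoD) auto
    then obtain N where N: "\<And>n. n \<ge> N \<Longrightarrow> X n \<in> ball z0 s"
      by (auto simp: eventually_sequentially)
    have ball: "X (n + N) \<in> ball z0 r" "X (n + N) \<in> ball z0 s" "X (n + N) \<noteq> z0" for n
      using N[of "n + N"] s X(1) by (auto simp: s_def)
    have XN: "(\<lambda>n. X (n + N)) \<longlonglongrightarrow> z0" using X(2) by (rule LIMSEQ_ignore_initial_segment)
    have lim: "(\<lambda>n. (f (X (n + N)) y - f z0 y) / (X (n + N) - z0)) \<longlonglongrightarrow> f' z0 y" for y
    proof -
      have "((\<lambda>z. (f z y - f z0 y) / (z - z0)) \<longlongrightarrow> f' z0 y) (at z0)"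
        using der[of z0 y] r by (simp add: has_field_derivative_iff)
      from this XN show ?thesis
        by (auto simp: tendsto_at_iff_sequentially comp_def ball dest!: spec[of _ "\<lambda>n. X (n + N)"])
    qed
    have mq: "(\<lambda>y. (f (X (n + N)) y - f z0 y) / (X (n + N) - z0)) \<in> borel_measurable M" for n
      by (intro borel_measurable_divide borel_measurable_diff meas ball(1) borel_measurable_const) (use r in simp)
    have "(\<lambda>n. integral\<^sup>L M (\<lambda>y. (f (X (n + N)) y - f z0 y) / (X (n + N) - z0))) \<longlonglongrightarrow> integral\<^sup>L M (f' z0)"
    proof (rule integral_dominated_convergence)
      \<comment> \<open>Measurability of the derivative is inherited from the difference quotients,
        whose pointwise limit it is.\<close>
      show "f' z0 \<in> borel_measurable M"
        by (rule borel_measurable_LIMSEQ_metric[OF mq lim])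
      show "integrable M (\<lambda>y. g y / (s / 2))" using g by simp
      show "AE y in M. norm ((f (X (n + N)) y - f z0 y) / (X (n + N) - z0)) \<le> g y / (s / 2)" for n
        using quot[OF ball(2,3)] by blast
    qed (use mq lim in auto)
    moreover have "integral\<^sup>L M (\<lambda>y. (f (X (n + N)) y - f z0 y) / (X (n + N) - z0)) =
        (integral\<^sup>L M (f (X (n + N))) - integral\<^sup>L M (f z0)) / (X (n + N) - z0)" for n
      using int[OF ball(1)] int[of z0] r by simp
    ultimately have "(\<lambda>n. (integral\<^sup>L M (f (X (n + N))) - integral\<^sup>L M (f z0)) / (X (n + N) - z0)) \<longlonglongrightarrow> integral\<^sup>L M (f' z0)"
      by (simp only:)
    then show "(\<lambda>n. (integral\<^sup>L M (f (X n)) - integral\<^sup>L M (f z0)) / (X n - z0)) \<longlonglongrightarrow> integral\<^sup>L M (f' z0)"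
      by (rule LIMSEQ_offset)
  qed
  then show ?thesis by (simp add: has_field_derivative_iff)
qed

text \<open>The ball of radius \<open>r - dist a b\<close> about \<open>b\<close> lies in
  \<open>ball a r\<close>. Holomorphy on a whole disc thus follows from a single majorant on that
  disc.\<close>

lemma has_field_derivative_integral_dominated:
  fixes f f' :: "complex \<Rightarrow> 'a \<Rightarrow> complex" and g :: "'a \<Rightarrow> real"
  assumes b: "b \<in> ball a r"
    and der: "\<And>z y. z \<in> ball a r \<Longrightarrow> ((\<lambda>z. f z y) has_field_derivative f' z y) (at z)"
    and meas: "\<And>z. z \<in> ball a r \<Longrightarrow> f z \<in> borel_measurable M"
    and bound: "\<And>z y. z \<in> ball a r \<Longrightarrow> norm (f z y) \<le> g y"
    and g: "integrable M g"
  shows "((\<lambda>z. integral\<^sup>L M (f z)) has_field_derivative integral\<^sup>L M (f' b)) (at b)"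
proof -
  have "z \<in> ball a r" if "z \<in> ball b (r - dist a b)" for z
    using that dist_triangle[of a z b] by (simp add: dist_commute)
  with assms show ?thesis
    by (intro has_field_derivative_integral_dominated_center[where r = "r - dist a b" and g = g]) auto
qed

text \<open>Real difference quotients are complex ones along the real axis, and \<open>Re\<close> is
  bounded linear. Agreement is asked for near \<open>x\<close> only, because in the time variable it
  is available for positive arguments only.\<close>

lemma has_real_derivative_of_complex:
  assumes "(G has_field_derivative D) (at (complex_of_real x))"
    and "eventually (\<lambda>y. G (complex_of_real y) = complex_of_real (h y)) (nhds x)"
  shows "(h has_real_derivative Re D) (at x)"
proof -
  have "((\<lambda>y. G (complex_of_real y)) has_vector_derivative D) (at x)"
    using assms(1) by (rule has_vector_derivative_real_field)
  from bounded_linear.has_vector_derivative[OF bounded_linear_Re this]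
  have "((\<lambda>y. Re (G (complex_of_real y))) has_real_derivative Re D) (at x)"
    by (simp add: has_real_derivative_iff_has_vector_derivative)
  moreover have "eventually (\<lambda>y. Re (G (complex_of_real y)) = h y) (nhds x)"
    using assms(2) by eventually_elim simp
  ultimately show ?thesis by (subst (asm) DERIV_cong_ev[OF refl _ refl])
qed

text \<open>The extension equals its Taylor series on the whole disc. At real \<open>y\<close> the
  powers of \<open>y - x\<close> are real, so taking real parts term by term leaves a series with
  real coefficients.\<close>

lemma real_analytic_on_of_holomorphic:
  assumes "\<And>x. x \<in> S \<Longrightarrow> \<exists>G r. r > 0 \<and> G holomorphic_on ball (complex_of_real x) r \<and>
             (\<forall>y. \<bar>y - x\<bar> < r \<longrightarrow> G (complex_of_real y) = complex_of_real (h y))"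
  shows "real_analytic_on S h"
  unfolding real_analytic_on_def
proof
  fix x assume "x \<in> S"
  from assms[OF this] obtain G r where r: "r > 0" and hol: "G holomorphic_on ball (complex_of_real x) r"
    and eq: "\<And>y. \<bar>y - x\<bar> < r \<Longrightarrow> G (complex_of_real y) = complex_of_real (h y)" by blast
  define a where "a n = Re ((deriv ^^ n) G (complex_of_real x) / fact n)" for n
  have "(\<lambda>n. a n * (y - x) ^ n) sums h y" if y: "\<bar>y - x\<bar> < r" for y
  proof -
    have "complex_of_real y \<in> ball (complex_of_real x) r"
      using y by (simp add: dist_norm abs_minus_commute flip: of_real_diff)
    from holomorphic_power_series[OF hol this]
    have "(\<lambda>n. Re ((deriv ^^ n) G (complex_of_real x) / fact n * (complex_of_real y - complex_of_real x) ^ n))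
        sums Re (G (complex_of_real y))" by (rule sums_Re)
    moreover have "Re ((deriv ^^ n) G (complex_of_real x) / fact n * (complex_of_real y - complex_of_real x) ^ n)
        = a n * (y - x) ^ n" for n
      unfolding a_def of_real_diff[symmetric] of_real_power[symmetric]
      by (simp only: times_complex.sel Re_complex_of_real Im_complex_of_real mult_zero_right diff_zero)
    ultimately show ?thesis using eq[OF y] by simp
  qed
  with r show "\<exists>r>0. \<exists>a. \<forall>y. \<bar>y - x\<bar> < r \<longrightarrow> (\<lambda>n. a n * (y - x) ^ n) sums h y" by blast
qed

section \<open>Gaussian moments\<close>

lemma heat_kernel_eq_normal_density: "t > 0 \<Longrightarrow> heat_kernel t x = normal_density 0 (sqrt (2 * t)) x"
  by (simp add: heat_kernel_def normal_density_def)

lemma heat_kernel_nonneg [simp]: "t > 0 \<Longrightarrow> heat_kernel t x \<ge> 0"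
  by (simp add: heat_kernel_def)

lemma borel_measurable_heat_kernel [measurable]: "heat_kernel t \<in> borel_measurable borel"
  unfolding heat_kernel_def[abs_def] by measurable

lemma heat_kernel_minus [simp]: "heat_kernel t (- x) = heat_kernel t x"
  by (simp add: heat_kernel_def)

lemma heat_kernel_has_derivative:
  assumes "t > 0"
  shows "(heat_kernel t has_real_derivative - x / (2 * t) * heat_kernel t x) (at x)"
  unfolding heat_kernel_def[abs_def] using assms
  by (auto intro!: derivative_eq_intros simp: field_simps)

lemma deriv_heat_kernel: "t > 0 \<Longrightarrow> deriv (heat_kernel t) x = - x / (2 * t) * heat_kernel t x"
  by (rule DERIV_imp_deriv[OF heat_kernel_has_derivative])

lemma heat_kernel_scale:
  assumes "t > 0" shows "sqrt t * heat_kernel t (sqrt t * w) = heat_kernel 1 w"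
  using assms by (simp add: heat_kernel_def real_sqrt_mult power_mult_distrib)

lemma integrable_gaussian_moment_abs:
  assumes "c > 0"
  shows "integrable lborel (\<lambda>y::real. \<bar>y - a\<bar> ^ k * exp (- (c * (y - a)\<^sup>2)))"
proof -
  define s where "s = sqrt (1 / (2 * c))"
  have s: "s > 0" "s\<^sup>2 = 1 / (2 * c)" using assms by (simp_all add: s_def)
  have "integrable lborel (\<lambda>y. sqrt (2 * pi * s\<^sup>2) * (normal_density a s y * \<bar>y - a\<bar> ^ k))"
    by (intro integrable_mult_right integrable_normal_moment_abs s)
  also have "(\<lambda>y. sqrt (2 * pi * s\<^sup>2) * (normal_density a s y * \<bar>y - a\<bar> ^ k)) =
      (\<lambda>y. \<bar>y - a\<bar> ^ k * exp (- (c * (y - a)\<^sup>2)))"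
    using assms by (simp add: normal_density_def s(2) fun_eq_iff)
  finally show ?thesis .
qed

lemma integrable_heat_moment_abs: "integrable lborel (\<lambda>w. \<bar>w\<bar> ^ k * heat_kernel 1 w)"
  using integrable_gaussian_moment_abs[of "1/4" 0 k]
  by (simp add: heat_kernel_def)

lemma integrable_heat_moment: "integrable lborel (\<lambda>w. w ^ k * heat_kernel 1 w)"
  using integrable_normal_moment[of "sqrt 2" 0 k]
  by (simp add: heat_kernel_eq_normal_density mult.commute)

lemma integral_heat_kernel: "(LINT w|lborel. heat_kernel 1 w) = 1"
  by (simp add: heat_kernel_eq_normal_density)

lemma integral_heat_moment_1: "(LINT w|lborel. w * heat_kernel 1 w) = 0"
  using integral_normal_moment_odd[of "sqrt 2" 0 0]
  by (simp add: heat_kernel_eq_normal_density mult.commute)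

text \<open>This moment is the source of the sharp constant: half the norm of \<open>f\<close>,
  times \<open>2 / sqrt pi\<close>, divided by the factor \<open>2 * sqrt t\<close> of
  \<open>conv_heat_scaled\<close>.\<close>

lemma integral_heat_moment_abs_1: "(LINT w|lborel. \<bar>w\<bar> * heat_kernel 1 w) = 2 / sqrt pi"
  using integral_normal_moment_abs_odd[of "sqrt 2" 0 0]
  by (simp add: heat_kernel_eq_normal_density mult.commute real_sqrt_divide)

text \<open>Without a condition at infinity the class contains \<open>cos\<close>. There
  \<open>at_pinf F\<close> is an unspecified real; the convolutions multiply it by a vanishing limit
  of the kernel or by its vanishing first moment.\<close>

definition BC :: "(real \<Rightarrow> real) set" where
  "BC = {F. continuous_on UNIV F \<and> bounded (range F)}"

lemma BC_bound:
  assumes "F \<in> BC" obtains M where "\<And>x. \<bar>F x\<bar> \<le> M" "M \<ge> 0"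
proof -
  from assms obtain M where "\<And>x. \<bar>F x\<bar> \<le> M" unfolding BC_def bounded_iff by auto
  then show ?thesis using that order_trans[OF abs_ge_zero] by blast
qed

lemma BC_measurable: "F \<in> BC \<Longrightarrow> F \<in> borel_measurable borel"
  unfolding BC_def by (auto intro: borel_measurable_continuous_onI)

lemma BC_isCont: "F \<in> BC \<Longrightarrow> isCont F x"
  unfolding BC_def by (auto simp: continuous_on_eq_continuous_at)

text \<open>The case \<open>k = 0\<close> is the convolution of \<open>F\<close> with the kernel,
  and \<open>k = 1\<close> yields that of \<open>f\<close> after multiplication by
  \<open>- 1 / (2 * t)\<close>. Other \<open>k\<close> arise by differentiation, as each derivative
  of the Gaussian brings down powers of \<open>x - \<xi>\<close>.\<close>

definition heat_moment :: "(real \<Rightarrow> real) \<Rightarrow> nat \<Rightarrow> real \<Rightarrow> real \<Rightarrow> real" where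
  "heat_moment F k t x = (LINT \<xi>|lborel. F \<xi> * (x - \<xi>) ^ k * heat_kernel t (x - \<xi>))"

lemma integrable_bounded_mult:
  fixes F g :: "real \<Rightarrow> real"
  assumes "integrable lborel g" "F \<in> borel_measurable borel" "\<And>x. \<bar>F x\<bar> \<le> M"
  shows "integrable lborel (\<lambda>x. F x * g x)"
proof (rule Bochner_Integration.integrable_bound)
  show "integrable lborel (\<lambda>x. M * \<bar>g x\<bar>)" using assms(1) by simp
  show "(\<lambda>x. F x * g x) \<in> borel_measurable lborel" using assms(1,2) by simp
  show "AE x in lborel. norm (F x * g x) \<le> norm (M * \<bar>g x\<bar>)"
    using assms(3) order_trans[OF abs_ge_zero assms(3)] by (auto simp: abs_mult intro!: mult_right_mono)
qed

lemma integrable_scaled_moment: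
  assumes F: "F \<in> BC"
  shows "integrable lborel (\<lambda>w. F (x - s * w) * (w ^ k * heat_kernel 1 w))"
proof -
  note [measurable] = BC_measurable[OF F]
  obtain M where "\<And>x. \<bar>F x\<bar> \<le> M" using BC_bound[OF F] by blast
  then show ?thesis by (intro integrable_bounded_mult[OF integrable_heat_moment]) auto
qed

text \<open>The substitution \<open>\<xi> = x - sqrt t * w\<close> moves all dependence on \<open>x\<close> and \<open>t\<close> into \<open>F\<close>.\<close>
lemma
  assumes F: "F \<in> BC" and t: "t > 0"
  shows integrable_heat_moment_kernel:
      "integrable lborel (\<lambda>\<xi>. F \<xi> * (x - \<xi>) ^ k * heat_kernel t (x - \<xi>))" (is ?int)
    and heat_moment_scaled: "heat_moment F k t x =
      sqrt t ^ k * (LINT w|lborel. F (x - sqrt t * w) * (w ^ k * heat_kernel 1 w))" (is ?eq)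
proof -
  let ?f = "\<lambda>\<xi>. F \<xi> * (x - \<xi>) ^ k * heat_kernel t (x - \<xi>)"
  have "\<bar>- sqrt t\<bar> *\<^sub>R ?f (x + (- sqrt t) * w) = sqrt t ^ k * (F (x - sqrt t * w) * (w ^ k * heat_kernel 1 w))" for w
    using heat_kernel_scale[OF t, of w] t by (simp add: power_mult_distrib)
  note eq = this
  have "integrable lborel (\<lambda>w. (1 / sqrt t) *\<^sub>R (\<bar>- sqrt t\<bar> *\<^sub>R ?f (x + (- sqrt t) * w)))"
    unfolding eq by (intro integrable_scaleR_right integrable_mult_right integrable_scaled_moment F)
  then have "integrable lborel (\<lambda>w. ?f (x + (- sqrt t) * w))"
    using t by simp
  then show ?int using t by (subst (asm) lborel_integrable_real_affine_iff) auto
  have "heat_moment F k t x = \<bar>- sqrt t\<bar> *\<^sub>R (LINT w|lborel. ?f (x + (- sqrt t) * w))"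
    unfolding heat_moment_def using t by (intro lborel_integral_real_affine) auto
  also have "\<dots> = (LINT w|lborel. \<bar>- sqrt t\<bar> *\<^sub>R ?f (x + (- sqrt t) * w))"
    by simp
  also have "\<dots> = sqrt t ^ k * (LINT w|lborel. F (x - sqrt t * w) * (w ^ k * heat_kernel 1 w))"
    unfolding eq by simp
  finally show ?eq .
qed

lemma continuous_on_heat_moment:
  assumes F: "F \<in> BC"
  shows "continuous_on (UNIV \<times> {0<..}) (\<lambda>(x, t). heat_moment F k t x)"
proof -
  note [measurable] = BC_measurable[OF F]
  obtain M where M: "\<And>x. \<bar>F x\<bar> \<le> M" "M \<ge> 0" using BC_bound[OF F] by blast
  let ?I = "\<lambda>x s. LINT w|lborel. F (x - s * w) * (w ^ k * heat_kernel 1 w)"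
  \<comment> \<open>In the variables \<open>x\<close> and \<open>s = sqrt t\<close> the majorant is
    the same at every point of the plane; \<open>t > 0\<close> enters when the substitution is
    undone.\<close>
  have I: "continuous_on UNIV (\<lambda>(x, s). ?I x s)"
  proof (rule continuous_on_sequentiallyI)
    fix u :: "nat \<Rightarrow> real \<times> real" and a assume "u \<longlonglongrightarrow> a"
    then have u: "(\<lambda>n. fst (u n)) \<longlonglongrightarrow> fst a" "(\<lambda>n. snd (u n)) \<longlonglongrightarrow> snd a"
      by (auto intro: tendsto_intros)
    have "(\<lambda>n. ?I (fst (u n)) (snd (u n))) \<longlonglongrightarrow> ?I (fst a) (snd a)"
    proof (rule integral_dominated_convergence)
      show "integrable lborel (\<lambda>w. M * (\<bar>w\<bar> ^ k * heat_kernel 1 w))"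
        by (intro integrable_mult_right integrable_heat_moment_abs)
      show "AE w in lborel. norm (F (fst (u n) - snd (u n) * w) * (w ^ k * heat_kernel 1 w))
              \<le> M * (\<bar>w\<bar> ^ k * heat_kernel 1 w)" for n
        by (intro AE_I2) (auto simp: abs_mult power_abs intro!: mult_right_mono M)
      show "AE w in lborel. (\<lambda>n. F (fst (u n) - snd (u n) * w) * (w ^ k * heat_kernel 1 w))
              \<longlonglongrightarrow> F (fst a - snd a * w) * (w ^ k * heat_kernel 1 w)"
        by (intro AE_I2 tendsto_mult_right isCont_tendsto_compose[OF BC_isCont[OF F]] tendsto_intros u)
    qed auto
    then show "(\<lambda>n. case u n of (x, s) \<Rightarrow> ?I x s) \<longlonglongrightarrow> (case a of (x, s) \<Rightarrow> ?I x s)"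
      by (simp add: case_prod_beta)
  qed
  have "continuous_on (UNIV \<times> {0<..}) (\<lambda>p::real \<times> real. sqrt (snd p) ^ k * (case (fst p, sqrt (snd p)) of (x, s) \<Rightarrow> ?I x s))"
    by (intro continuous_intros continuous_on_compose2[OF I]) auto
  then show ?thesis
    by (rule continuous_on_eq) (auto simp: heat_moment_scaled[OF F])
qed

section \<open>Analyticity in space\<close>

text \<open>Bounding a sum by twice its maximum replaces the binomial expansion, so that the
  majorant below consists of just two Gaussian moments.\<close>

lemma power_add_le:
  fixes a b :: real
  assumes "a \<ge> 0" "b \<ge> 0" shows "(a + b) ^ k \<le> (2 * a) ^ k + (2 * b) ^ k"
proof -
  have "(a + b) ^ k \<le> (2 * max a b) ^ k" using assms by (intro power_mono) auto
  also have "\<dots> \<le> (2 * a) ^ k + (2 * b) ^ k" using assms by (simp add: max_def)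
  finally show ?thesis .
qed

text \<open>For real time the modulus of the exponential is
  \<open>exp (((Im z)^2 - (Re z - \<xi>)^2) / (4 * t))\<close>. Moving the centre by less than 1
  costs the constant \<open>exp (1 / (2 * t))\<close> and half of the rate
  \<open>1 / (4 * t)\<close>. The factor \<open>\<bar>\<xi> - x\<bar> ^ 0\<close> keeps the second
  summand in the shape of a Gaussian moment.\<close>

lemma gaussian_bound_x:
  fixes t x \<xi> :: real
  assumes t: "t > 0" and z: "norm (z - complex_of_real x) < 1"
  shows "norm ((z - complex_of_real \<xi>) ^ k * exp (- (z - complex_of_real \<xi>)\<^sup>2 / (4 * complex_of_real t)))
    \<le> exp (1 / (2 * t)) * (2 ^ k * (\<bar>\<xi> - x\<bar> ^ k * exp (- (1 / (8 * t) * (\<xi> - x)\<^sup>2)))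
         + 2 ^ k * (\<bar>\<xi> - x\<bar> ^ 0 * exp (- (1 / (8 * t) * (\<xi> - x)\<^sup>2))))"
proof -
  have re: "\<bar>Re z - x\<bar> < 1" using z abs_Re_le_cmod[of "z - complex_of_real x"] by simp
  have im: "\<bar>Im z\<bar> < 1" using z abs_Im_le_cmod[of "z - complex_of_real x"] by simp
  have "norm (z - complex_of_real \<xi>) \<le> norm (z - complex_of_real x) + norm (complex_of_real x - complex_of_real \<xi>)"
    using norm_triangle_ineq[of "z - complex_of_real x" "complex_of_real x - complex_of_real \<xi>"] by simp
  also have "norm (complex_of_real x - complex_of_real \<xi>) = \<bar>\<xi> - x\<bar>"
    by (simp flip: of_real_diff add: abs_minus_commute)
  finally have "norm (z - complex_of_real \<xi>) \<le> \<bar>\<xi> - x\<bar> + 1" using z by simp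
  then have "norm (z - complex_of_real \<xi>) ^ k \<le> (\<bar>\<xi> - x\<bar> + 1) ^ k" by (rule power_mono) simp
  also have "\<dots> \<le> (2 * \<bar>\<xi> - x\<bar>) ^ k + (2 * 1) ^ k" by (rule power_add_le) auto
  finally have p: "norm ((z - complex_of_real \<xi>) ^ k) \<le> 2 ^ k * \<bar>\<xi> - x\<bar> ^ k + 2 ^ k"
    by (simp add: norm_power power_mult_distrib)
  have sq1: "(Im z)\<^sup>2 \<le> 1" "(Re z - x)\<^sup>2 \<le> 1" using re im by (simp_all add: abs_square_le_1)
  have "(\<xi> - x)\<^sup>2 \<le> 2 * (Re z - \<xi>)\<^sup>2 + 2 * (Re z - x)\<^sup>2"
    using zero_le_power2[of "(Re z - x) + (Re z - \<xi>)"] by (simp add: power2_eq_square algebra_simps)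
  with sq1 have "(Im z)\<^sup>2 - (Re z - \<xi>)\<^sup>2 \<le> 2 - (\<xi> - x)\<^sup>2 / 2" by linarith
  moreover have "Re (- (z - complex_of_real \<xi>)\<^sup>2 / (4 * complex_of_real t)) = ((Im z)\<^sup>2 - (Re z - \<xi>)\<^sup>2) / (4 * t)"
  proof -
    have "- (z - complex_of_real \<xi>)\<^sup>2 / (4 * complex_of_real t) = - (z - complex_of_real \<xi>)\<^sup>2 / complex_of_real (4 * t)" by simp
    also have "Re \<dots> = ((Im z)\<^sup>2 - (Re z - \<xi>)\<^sup>2) / (4 * t)"
      by (simp only: Re_divide_of_real) (simp add: power2_eq_square)
    finally show ?thesis .
  qed
  ultimately have "Re (- (z - complex_of_real \<xi>)\<^sup>2 / (4 * complex_of_real t)) \<le> (2 - (\<xi> - x)\<^sup>2 / 2) / (4 * t)"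
    using t by (simp add: divide_right_mono)
  also have "\<dots> = 1 / (2 * t) + - (1 / (8 * t) * (\<xi> - x)\<^sup>2)" using t by (simp add: field_simps)
  finally have "norm (exp (- (z - complex_of_real \<xi>)\<^sup>2 / (4 * complex_of_real t))) \<le>
      exp (1 / (2 * t)) * exp (- (1 / (8 * t) * (\<xi> - x)\<^sup>2))" by (simp flip: exp_add)
  with p have "norm ((z - complex_of_real \<xi>) ^ k * exp (- (z - complex_of_real \<xi>)\<^sup>2 / (4 * complex_of_real t)))
    \<le> (2 ^ k * \<bar>\<xi> - x\<bar> ^ k + 2 ^ k) * (exp (1 / (2 * t)) * exp (- (1 / (8 * t) * (\<xi> - x)\<^sup>2)))"
    unfolding norm_mult by (intro mult_mono) auto
  then show ?thesis by (simp add: algebra_simps)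
qed

text \<open>Only the space variable becomes complex. Time stays real, so the normalising root needs
  no branch and can be kept with \<open>F\<close>.\<close>

definition cheat_x :: "(real \<Rightarrow> real) \<Rightarrow> nat \<Rightarrow> real \<Rightarrow> complex \<Rightarrow> complex" where
  "cheat_x F k t z = (LINT \<xi>|lborel. complex_of_real (F \<xi> / sqrt (4 * pi * t)) *
     ((z - complex_of_real \<xi>) ^ k * exp (- (z - complex_of_real \<xi>)\<^sup>2 / (4 * complex_of_real t))))"

lemma cheat_x_of_real: "cheat_x F k t (complex_of_real x) = complex_of_real (heat_moment F k t x)"
  unfolding cheat_x_def heat_moment_def integral_complex_of_real[symmetric]
  by (intro Bochner_Integration.integral_cong refl)
     (simp add: heat_kernel_def flip: exp_of_real)

lemma cheat_x_has_derivative: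
  assumes F: "F \<in> BC" and t: "t > 0" and z: "norm (z - complex_of_real x) < 1"
  shows "(cheat_x F k t has_field_derivative
     (LINT \<xi>|lborel. complex_of_real (F \<xi> / sqrt (4 * pi * t)) *
       ((of_nat k * (z - complex_of_real \<xi>) ^ (k - 1)
          - (z - complex_of_real \<xi>) ^ (k + 1) / (2 * complex_of_real t)) *
         exp (- (z - complex_of_real \<xi>)\<^sup>2 / (4 * complex_of_real t))))) (at (z))"
proof -
  note [measurable] = BC_measurable[OF F]
  obtain M where M: "\<And>x. \<bar>F x\<bar> \<le> M" "M \<ge> 0" using BC_bound[OF F] by blast
  let ?g = "\<lambda>\<xi>. exp (1 / (2 * t)) * (2 ^ k * (\<bar>\<xi> - x\<bar> ^ k * exp (- (1 / (8 * t) * (\<xi> - x)\<^sup>2)))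
         + 2 ^ k * (\<bar>\<xi> - x\<bar> ^ 0 * exp (- (1 / (8 * t) * (\<xi> - x)\<^sup>2))))"
  show ?thesis
    unfolding cheat_x_def[abs_def]
  proof (rule has_field_derivative_integral_dominated[where r = 1 and a = "complex_of_real x" and
        f' = "\<lambda>z \<xi>. complex_of_real (F \<xi> / sqrt (4 * pi * t)) *
       ((of_nat k * (z - complex_of_real \<xi>) ^ (k - 1)
          - (z - complex_of_real \<xi>) ^ (k + 1) / (2 * complex_of_real t)) *
         exp (- (z - complex_of_real \<xi>)\<^sup>2 / (4 * complex_of_real t)))"
        and g = "\<lambda>\<xi>. M / sqrt (4 * pi * t) * ?g \<xi>"])
    show "integrable lborel (\<lambda>\<xi>. M / sqrt (4 * pi * t) * ?g \<xi>)"
      using t by (intro integrable_mult_right Bochner_Integration.integrable_add integrable_gaussian_moment_abs) auto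
    show "norm (complex_of_real (F \<xi> / sqrt (4 * pi * t)) *
        ((z - complex_of_real \<xi>) ^ k * exp (- (z - complex_of_real \<xi>)\<^sup>2 / (4 * complex_of_real t))))
      \<le> M / sqrt (4 * pi * t) * ?g \<xi>" if "z \<in> ball (complex_of_real x) 1" for z \<xi>
      unfolding norm_mult[of "complex_of_real _"]
      using that t M
      by (intro mult_mono gaussian_bound_x) (auto simp: dist_norm norm_minus_commute norm_divide intro!: divide_right_mono)
    show "((\<lambda>z. complex_of_real (F \<xi> / sqrt (4 * pi * t)) *
        ((z - complex_of_real \<xi>) ^ k * exp (- (z - complex_of_real \<xi>)\<^sup>2 / (4 * complex_of_real t)))) has_field_derivative
       complex_of_real (F \<xi> / sqrt (4 * pi * t)) *
       ((of_nat k * (z - complex_of_real \<xi>) ^ (k - 1)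
          - (z - complex_of_real \<xi>) ^ (k + 1) / (2 * complex_of_real t)) *
         exp (- (z - complex_of_real \<xi>)\<^sup>2 / (4 * complex_of_real t)))) (at z)" for z \<xi>
      using t by (auto intro!: derivative_eq_intros simp: field_simps power2_eq_square)
  qed (use z in \<open>auto simp: dist_norm norm_minus_commute\<close>)
qed

text \<open>The product rule under the integral, the Gaussian contributing the factor
  \<open>- (x - \<xi>) / (2 * t)\<close>. At \<open>k = 0\<close> the truncated \<open>k - 1\<close>
  is \<open>0\<close>, but the coefficient \<open>real k\<close> vanishes.\<close>

lemma heat_moment_has_derivative_x:
  assumes F: "F \<in> BC" and t: "t > 0"
  shows "((\<lambda>x. heat_moment F k t x) has_real_derivative
      real k * heat_moment F (k - 1) t x - heat_moment F (k + 1) t x / (2 * t)) (at x)"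
proof -
  let ?h = "\<lambda>k \<xi>. F \<xi> * (x - \<xi>) ^ k * heat_kernel t (x - \<xi>)"
  note int = integrable_heat_moment_kernel[OF F t]
  have "(LINT \<xi>|lborel. complex_of_real (F \<xi> / sqrt (4 * pi * t)) *
       ((of_nat k * (complex_of_real x - complex_of_real \<xi>) ^ (k - 1)
          - (complex_of_real x - complex_of_real \<xi>) ^ (k + 1) / (2 * complex_of_real t)) *
         exp (- (complex_of_real x - complex_of_real \<xi>)\<^sup>2 / (4 * complex_of_real t)))) =
      (LINT \<xi>|lborel. complex_of_real (real k * ?h (k - 1) \<xi> - 1 / (2 * t) * ?h (k + 1) \<xi>))"
    by (intro Bochner_Integration.integral_cong refl)
       (use t in \<open>simp add: heat_kernel_def field_simps flip: exp_of_real\<close>)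
  also have "\<dots> = complex_of_real (LINT \<xi>|lborel. real k * ?h (k - 1) \<xi> - 1 / (2 * t) * ?h (k + 1) \<xi>)"
    by (rule integral_complex_of_real)
  also have "(LINT \<xi>|lborel. real k * ?h (k - 1) \<xi> - 1 / (2 * t) * ?h (k + 1) \<xi>) =
      real k * heat_moment F (k - 1) t x - 1 / (2 * t) * heat_moment F (k + 1) t x"
    unfolding heat_moment_def
    by (subst Bochner_Integration.integral_diff) (auto intro!: integrable_mult_right int simp del: power_Suc)
  finally have "(cheat_x F k t has_field_derivative complex_of_real
       (real k * heat_moment F (k - 1) t x - 1 / (2 * t) * heat_moment F (k + 1) t x)) (at (complex_of_real x))"
    using cheat_x_has_derivative[OF F t, of "complex_of_real x" x k] by simp
  from has_real_derivative_of_complex[OF this, of "heat_moment F k t"]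
  show ?thesis by (simp add: cheat_x_of_real)
qed

lemma real_analytic_heat_moment_x:
  assumes F: "F \<in> BC" and t: "t > 0"
  shows "real_analytic_on UNIV (heat_moment F k t)"
proof (rule real_analytic_on_of_holomorphic, intro exI conjI allI impI)
  fix x
  show "cheat_x F k t holomorphic_on ball (complex_of_real x) 1"
    unfolding holomorphic_on_open[OF open_ball]
  proof
    fix z assume "z \<in> ball (complex_of_real x) 1"
    then have "norm (z - complex_of_real x) < 1" by (simp add: dist_norm norm_minus_commute)
    from cheat_x_has_derivative[OF F t this, of k]
    show "\<exists>f'. (cheat_x F k t has_field_derivative f') (at z)" ..
  qed
qed (auto simp: cheat_x_of_real)

section \<open>Analyticity in time\<close>

text \<open>In complex time the Gaussian decays at rate \<open>Re (1 / s) / 4\<close>, which has to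
  stay away from 0. On the disc \<open>Re s \<ge> t / 2\<close> and
  \<open>norm s \<le> 3 / 2 * t\<close>; the constant is the resulting bound for
  \<open>Re s / (norm s)^2\<close>.\<close>

lemma Re_inverse_lower_bound:
  assumes t: "t > 0" and s: "norm (s - complex_of_real t) < t / 2"
  shows "Re s > 0" "Re (1 / s) \<ge> 2 / (9 * t)"
proof -
  have re: "\<bar>Re s - t\<bar> < t / 2" using s abs_Re_le_cmod[of "s - complex_of_real t"] by simp
  then show pos: "Re s > 0" by linarith
  have "norm s \<le> norm (s - complex_of_real t) + norm (complex_of_real t)"
    using norm_triangle_ineq[of "s - complex_of_real t" "complex_of_real t"] by simp
  then have "norm s \<le> 3 / 2 * t" using s t by simp
  then have "(norm s)\<^sup>2 \<le> (3 / 2 * t)\<^sup>2" by (intro power_mono) auto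
  then have n: "(norm s)\<^sup>2 \<le> 9 / 4 * t\<^sup>2" by (simp add: power_mult_distrib power2_eq_square)
  have "s \<noteq> 0" using pos by auto
  have "t / 2 \<le> Re s" using re by linarith
  have "2 / (9 * t) = (t / 2) / (9 / 4 * t\<^sup>2)" using t by (simp add: power2_eq_square)
  also have "\<dots> \<le> Re s / (norm s)\<^sup>2"
    using n pos \<open>t / 2 \<le> Re s\<close> \<open>s \<noteq> 0\<close> by (intro frac_le) auto
  also have "\<dots> = Re (1 / s)" by (simp add: Re_divide cmod_power2)
  finally show "Re (1 / s) \<ge> 2 / (9 * t)" .
qed

text \<open>The normalising factor is left out: it does not depend on \<open>\<xi>\<close>, and a
  complex square root is easier to restore outside the integral.\<close>

definition cheat_t :: "(real \<Rightarrow> real) \<Rightarrow> nat \<Rightarrow> real \<Rightarrow> complex \<Rightarrow> complex" where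
  "cheat_t F k x s = (LINT \<xi>|lborel. complex_of_real (F \<xi> * (x - \<xi>) ^ k) *
     exp (- complex_of_real ((\<xi> - x)\<^sup>2 / 4) * (1 / s)))"

lemma cheat_t_of_real:
  assumes "t > 0"
  shows "cheat_t F k x (complex_of_real t) / csqrt (complex_of_real (4 * pi * t)) = complex_of_real (heat_moment F k t x)"
proof -
  have "complex_of_real (F \<xi> * (x - \<xi>) ^ k) * exp (- complex_of_real ((\<xi> - x)\<^sup>2 / 4) * (1 / complex_of_real t))
     = complex_of_real (sqrt (4 * pi * t) * (F \<xi> * (x - \<xi>) ^ k * heat_kernel t (x - \<xi>)))" for \<xi>
    using assms by (simp add: heat_kernel_def power2_commute[of \<xi> x] flip: exp_of_real)
  then have "cheat_t F k x (complex_of_real t) = complex_of_real (sqrt (4 * pi * t) * heat_moment F k t x)"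
    unfolding cheat_t_def heat_moment_def
    by (simp only: integral_complex_of_real Bochner_Integration.integral_mult_right_zero)
  moreover have "csqrt (complex_of_real (4 * pi * t)) = complex_of_real (sqrt (4 * pi * t))"
    using assms by (intro of_real_sqrt[symmetric]) simp
  ultimately show ?thesis using assms by simp
qed

lemma cheat_t_has_derivative:
  assumes F: "F \<in> BC" and t: "t > 0" and s: "norm (s - complex_of_real t) < t / 2"
  shows "(cheat_t F k x has_field_derivative
     (LINT \<xi>|lborel. complex_of_real (F \<xi> * (x - \<xi>) ^ k) *
       (complex_of_real ((\<xi> - x)\<^sup>2 / 4) / s\<^sup>2 * exp (- complex_of_real ((\<xi> - x)\<^sup>2 / 4) * (1 / s))))) (at s)"
proof -
  note [measurable] = BC_measurable[OF F]
  obtain M where M: "\<And>x. \<bar>F x\<bar> \<le> M" "M \<ge> 0" using BC_bound[OF F] by blast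
  show ?thesis
    unfolding cheat_t_def[abs_def]
  proof (rule has_field_derivative_integral_dominated[where r = "t / 2" and a = "complex_of_real t" and
        f' = "\<lambda>s \<xi>. complex_of_real (F \<xi> * (x - \<xi>) ^ k) *
       (complex_of_real ((\<xi> - x)\<^sup>2 / 4) / s\<^sup>2 * exp (- complex_of_real ((\<xi> - x)\<^sup>2 / 4) * (1 / s)))"
        \<comment> \<open>The rate \<open>1 / (18 * t)\<close> is \<open>1 / 4\<close> times the
          lower bound \<open>2 / (9 * t)\<close> for \<open>Re (1 / s)\<close>.\<close>
        and g = "\<lambda>\<xi>. M * (\<bar>\<xi> - x\<bar> ^ k * exp (- (1 / (18 * t) * (\<xi> - x)\<^sup>2)))"])
    show "integrable lborel (\<lambda>\<xi>. M * (\<bar>\<xi> - x\<bar> ^ k * exp (- (1 / (18 * t) * (\<xi> - x)\<^sup>2))))"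
      using t by (intro integrable_mult_right integrable_gaussian_moment_abs) auto
    show "norm (complex_of_real (F \<xi> * (x - \<xi>) ^ k) * exp (- complex_of_real ((\<xi> - x)\<^sup>2 / 4) * (1 / s)))
      \<le> M * (\<bar>\<xi> - x\<bar> ^ k * exp (- (1 / (18 * t) * (\<xi> - x)\<^sup>2)))" if "s \<in> ball (complex_of_real t) (t / 2)" for s \<xi>
    proof -
      have "2 / (9 * t) \<le> Re (1 / s)"
        using that by (intro Re_inverse_lower_bound t) (simp add: dist_norm norm_minus_commute)
      then have "(\<xi> - x)\<^sup>2 / 4 * (2 / (9 * t)) \<le> (\<xi> - x)\<^sup>2 / 4 * Re (1 / s)"
        by (intro mult_left_mono) auto
      moreover have "Re (- complex_of_real ((\<xi> - x)\<^sup>2 / 4) * (1 / s)) = - ((\<xi> - x)\<^sup>2 / 4 * Re (1 / s))"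
        unfolding of_real_minus[symmetric] times_complex.sel by simp
      ultimately have "norm (exp (- complex_of_real ((\<xi> - x)\<^sup>2 / 4) * (1 / s))) \<le> exp (- (1 / (18 * t) * (\<xi> - x)\<^sup>2))"
        unfolding norm_exp_eq_Re by simp
      moreover have "norm (complex_of_real (F \<xi> * (x - \<xi>) ^ k)) \<le> M * \<bar>\<xi> - x\<bar> ^ k"
        unfolding norm_of_real abs_mult power_abs abs_minus_commute[of x] by (intro mult_right_mono M) simp
      ultimately have "norm (complex_of_real (F \<xi> * (x - \<xi>) ^ k)) * norm (exp (- complex_of_real ((\<xi> - x)\<^sup>2 / 4) * (1 / s)))
        \<le> (M * \<bar>\<xi> - x\<bar> ^ k) * exp (- (1 / (18 * t) * (\<xi> - x)\<^sup>2))"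
        using M by (intro mult_mono) auto
      then show ?thesis unfolding norm_mult[of "complex_of_real _" "exp _"] by (simp only: mult.assoc)
    qed
    show "((\<lambda>s. complex_of_real (F \<xi> * (x - \<xi>) ^ k) * exp (- complex_of_real ((\<xi> - x)\<^sup>2 / 4) * (1 / s))) has_field_derivative
       complex_of_real (F \<xi> * (x - \<xi>) ^ k) *
       (complex_of_real ((\<xi> - x)\<^sup>2 / 4) / s\<^sup>2 * exp (- complex_of_real ((\<xi> - x)\<^sup>2 / 4) * (1 / s)))) (at s)"
      if "s \<in> ball (complex_of_real t) (t / 2)" for s \<xi>
    proof -
      have "s \<noteq> 0" using Re_inverse_lower_bound[OF t, of s] that by (auto simp: dist_norm norm_minus_commute)
      then show ?thesis
        by (auto intro!: derivative_eq_intros simp: power2_eq_square)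
    qed
  qed (use s in \<open>auto simp: dist_norm norm_minus_commute\<close>)
qed

text \<open>Without its normaliser the Gaussian has time derivative
  \<open>(x - \<xi>)^2 / (4 * t^2)\<close> times itself, which raises the moment by two. Dividing
  \<open>J\<close> by \<open>sqrt (4 * pi * t)\<close> produces the second term.\<close>

lemma heat_moment_has_derivative_t:
  assumes F: "F \<in> BC" and t: "t > 0"
  shows "((\<lambda>t. heat_moment F k t x) has_real_derivative
      heat_moment F (k + 2) t x / (4 * t\<^sup>2) - heat_moment F k t x / (2 * t)) (at t)"
proof -
  let ?h = "\<lambda>k \<xi>. F \<xi> * (x - \<xi>) ^ k * heat_kernel t (x - \<xi>)"
  define J where "J t = sqrt (4 * pi * t) * heat_moment F k t x" for t
  have ct: "cheat_t F k x (complex_of_real t) = complex_of_real (J t)" if "t > 0" for t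
    using cheat_t_of_real[OF that, of F k x] that unfolding J_def
    by (subst (asm) csqrt_of_real_nonneg) (auto simp: field_simps)
  have "(LINT \<xi>|lborel. complex_of_real (F \<xi> * (x - \<xi>) ^ k) *
       (complex_of_real ((\<xi> - x)\<^sup>2 / 4) / (complex_of_real t)\<^sup>2 * exp (- complex_of_real ((\<xi> - x)\<^sup>2 / 4) * (1 / complex_of_real t)))) =
      (LINT \<xi>|lborel. complex_of_real (sqrt (4 * pi * t) / (4 * t\<^sup>2) * ?h (k + 2) \<xi>))"
    by (intro Bochner_Integration.integral_cong refl)
       (use t in \<open>simp add: heat_kernel_def power2_commute[of _ x] power_add flip: exp_of_real\<close>, simp add: power2_eq_square)
  also have "\<dots> = complex_of_real (sqrt (4 * pi * t) / (4 * t\<^sup>2) * heat_moment F (k + 2) t x)"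
    unfolding heat_moment_def by (simp only: integral_complex_of_real Bochner_Integration.integral_mult_right_zero)
  finally have D: "(cheat_t F k x has_field_derivative complex_of_real
       (sqrt (4 * pi * t) / (4 * t\<^sup>2) * heat_moment F (k + 2) t x)) (at (complex_of_real t))"
    using cheat_t_has_derivative[OF F t, of "complex_of_real t" k x] t by simp
  have pos: "eventually (\<lambda>t. t > 0) (nhds t)"
    using eventually_nhds_in_open[of "{0<..}" t] t by simp
  then have ev: "eventually (\<lambda>t. cheat_t F k x (complex_of_real t) = complex_of_real (J t)) (nhds t)"
    by eventually_elim (rule ct)
  have J: "(J has_real_derivative sqrt (4 * pi * t) / (4 * t\<^sup>2) * heat_moment F (k + 2) t x) (at t)"
    using has_real_derivative_of_complex[OF D ev] by (simp only: Re_complex_of_real)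
  have "((\<lambda>t. J t / sqrt (4 * pi * t)) has_real_derivative
      heat_moment F (k + 2) t x / (4 * t\<^sup>2) - heat_moment F k t x / (2 * t)) (at t)"
    using t by (auto intro!: derivative_eq_intros J simp: J_def[of t] field_simps mult_less_0_iff)
  moreover have "eventually (\<lambda>t. J t / sqrt (4 * pi * t) = heat_moment F k t x) (nhds t)"
    using pos by eventually_elim (simp add: J_def)
  ultimately show ?thesis by (subst (asm) DERIV_cong_ev[OF refl _ refl])
qed

text \<open>The disc of radius \<open>t / 2\<close> lies in the right half-plane, clear of the pole
  of a negative power of \<open>s\<close> and of the branch cut of \<open>csqrt\<close>. The integer
  power accommodates the factor \<open>1 / t\<close> in the solution.\<close>

lemma real_analytic_heat_moment_t:
  assumes F: "F \<in> BC" and h: "\<And>t. t > 0 \<Longrightarrow> h t = c * t powi m * heat_moment F k t x"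
  shows "real_analytic_on {0<..} h"
proof (rule real_analytic_on_of_holomorphic)
  fix t :: real assume "t \<in> {0<..}"
  then have t: "t > 0" by simp
  define G where "G s = complex_of_real c * s powi m * (cheat_t F k x s / csqrt (4 * complex_of_real pi * s))" for s
  have "G holomorphic_on ball (complex_of_real t) (t / 2)"
  proof -
    have B: "norm (s - complex_of_real t) < t / 2" if "s \<in> ball (complex_of_real t) (t / 2)" for s
      using that by (simp add: dist_norm norm_minus_commute)
    have pos: "Re s > 0" if "s \<in> ball (complex_of_real t) (t / 2)" for s
      by (rule Re_inverse_lower_bound(1)[OF t B[OF that]])
    have "cheat_t F k x holomorphic_on ball (complex_of_real t) (t / 2)"
      unfolding holomorphic_on_open[OF open_ball]
      using cheat_t_has_derivative[OF F t B, of _ k x] by blast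
    moreover have "s \<noteq> 0" "4 * complex_of_real pi * s \<notin> \<real>\<^sub>\<le>\<^sub>0" if "s \<in> ball (complex_of_real t) (t / 2)" for s
      using pos[OF that] pi_gt_zero by (auto simp: complex_nonpos_Reals_iff mult_le_0_iff simp del: pi_gt_zero)
    ultimately show ?thesis
      unfolding G_def by (intro holomorphic_intros) auto
  qed
  moreover have "G (complex_of_real y) = complex_of_real (h y)" if "\<bar>y - t\<bar> < t / 2" for y
  proof -
    have "y > 0" using that by linarith
    from cheat_t_of_real[OF this, of F k x] h[OF this] show ?thesis
      by (simp add: G_def)
  qed
  ultimately show "\<exists>G r. r > 0 \<and> G holomorphic_on ball (complex_of_real t) r \<and>
             (\<forall>y. \<bar>y - t\<bar> < r \<longrightarrow> G (complex_of_real y) = complex_of_real (h y))"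
    using t by (intro exI[of _ G] exI[of _ "t / 2"]) auto
qed

section \<open>The Henstock--Stieltjes integral\<close>

lemma Cbar_subset_BC: "Cbar \<subseteq> BC"
proof
  fix F assume F: "F \<in> Cbar"
  then obtain l m where cont: "continuous_on UNIV F" and "(F \<longlongrightarrow> l) at_top" "(F \<longlongrightarrow> m) at_bot"
    by (auto simp: Cbar_def)
  then have "eventually (\<lambda>x. dist (F x) l < 1) at_top" "eventually (\<lambda>x. dist (F x) m < 1) at_bot"
    by (auto intro: tendstoD)
  then obtain a b where a: "\<And>x. x \<ge> a \<Longrightarrow> dist (F x) l < 1" and b: "\<And>x. x \<le> b \<Longrightarrow> dist (F x) m < 1"
    by (auto simp: eventually_at_top_linorder eventually_at_bot_linorder)
  have "range F \<subseteq> F ` {b..a} \<union> ball l 1 \<union> ball m 1"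
    using a b by (force simp: dist_commute not_le intro: less_imp_le)
  moreover have "bounded (F ` {b..a})"
    using continuous_on_subset[OF cont] by (intro compact_imp_bounded compact_continuous_image) auto
  ultimately have "bounded (range F)"
    by (meson bounded_Un bounded_ball bounded_subset)
  with cont show "F \<in> BC" by (simp add: BC_def)
qed

lemma Bc_imp_BC: "F \<in> Bc \<Longrightarrow> F \<in> BC"
  using Cbar_subset_BC by (auto simp: Bc_def)

lemma Bc_tendsto:
  assumes "F \<in> Bc"
  shows "(F \<longlongrightarrow> at_pinf F) at_top" "(F \<longlongrightarrow> 0) at_bot"
proof -
  from assms obtain l where "(F \<longlongrightarrow> l) at_top" "(F \<longlongrightarrow> 0) at_bot" by (auto simp: Bc_def Cbar_def)
  moreover from this have "at_pinf F = l" unfolding at_pinf_def by (intro tendsto_Lim) auto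
  ultimately show "(F \<longlongrightarrow> at_pinf F) at_top" "(F \<longlongrightarrow> 0) at_bot" by simp_all
qed

lemma at_minf_eq: "(F \<longlongrightarrow> l) at_bot \<Longrightarrow> at_minf F = l"
  unfolding at_minf_def by (intro tendsto_Lim) auto

lemma at_pinf_eq: "(F \<longlongrightarrow> l) at_top \<Longrightarrow> at_pinf F = l"
  unfolding at_pinf_def by (intro tendsto_Lim) auto

text \<open>Intersecting two gauges gives a gauge, and by Cousin's lemma some division is fine for
  it. Uniqueness gives the definite description \<open>hs_integral_on\<close> its value.\<close>

lemma hs_has_integral_on_unique:
  assumes "hs_has_integral_on F g I a b" "hs_has_integral_on F g J a b"
  shows "I = J"
proof (rule ccontr)
  assume "I \<noteq> J"
  then have e: "\<bar>I - J\<bar> / 2 > 0" by simp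
  from assms e obtain \<gamma> \<delta> where g: "gauge \<gamma>" "gauge \<delta>"
    and \<gamma>: "\<And>p. p tagged_division_of {a..b} \<Longrightarrow> \<gamma> fine p \<Longrightarrow>
        \<bar>(\<Sum>(x,K)\<in>p. F x * (g (Sup K) - g (Inf K))) - I\<bar> < \<bar>I - J\<bar> / 2"
    and \<delta>: "\<And>p. p tagged_division_of {a..b} \<Longrightarrow> \<delta> fine p \<Longrightarrow>
        \<bar>(\<Sum>(x,K)\<in>p. F x * (g (Sup K) - g (Inf K))) - J\<bar> < \<bar>I - J\<bar> / 2"
    unfolding hs_has_integral_on_def by meson
  from fine_division_exists_real[OF gauge_Int[OF g]] obtain p
    where p: "p tagged_division_of {a..b}" "(\<lambda>x. \<gamma> x \<inter> \<delta> x) fine p" by blast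
  then have "\<gamma> fine p" "\<delta> fine p" by (auto simp: fine_Int)
  then have "\<bar>(\<Sum>(x,K)\<in>p. F x * (g (Sup K) - g (Inf K))) - I\<bar> + \<bar>(\<Sum>(x,K)\<in>p. F x * (g (Sup K) - g (Inf K))) - J\<bar> < \<bar>I - J\<bar>"
    by (intro order_less_le_trans[OF add_strict_mono[OF \<gamma>[OF p(1)] \<delta>[OF p(1)]]]) simp_all
  then show False by (simp add: abs_if split: if_splits)
qed

text \<open>For a continuously differentiable integrator a constant gauge from uniform continuity of
  \<open>F\<close> suffices: on a piece with tag \<open>x\<close> the error is the integral of
  \<open>(F x - F y) * g' y\<close>.\<close>

lemma hs_has_integral_on_C1:
  assumes F: "continuous_on UNIV F"
    and g: "\<And>x. (g has_real_derivative g' x) (at x)" and g': "continuous_on UNIV g'"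
    and ab: "a \<le> b"
  shows "hs_has_integral_on F g (integral {a..b} (\<lambda>x. F x * g' x)) a b"
  unfolding hs_has_integral_on_def
proof (intro allI impI)
  fix e :: real assume e: "e > 0"
  note c = continuous_on_subset[OF _ subset_UNIV]
  have "bounded (g' ` {a..b})"
    by (intro compact_imp_bounded compact_continuous_image c[OF g']) auto
  then obtain M where M: "M > 0" "\<And>x. x \<in> {a..b} \<Longrightarrow> \<bar>g' x\<bar> \<le> M"
    by (auto simp: bounded_pos)
  \<comment> \<open>The summand 1 keeps the denominator positive when \<open>a = b\<close>; the
    factor 2 makes the final estimate strict.\<close>
  define d where "d = e / (2 * M * (b - a + 1))"
  have d: "d > 0" using e M ab by (simp add: d_def)
  have "uniformly_continuous_on {a..b} F"
    by (intro compact_uniformly_continuous c[OF F]) auto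
  then obtain r where r: "r > 0" "\<And>x y. x \<in> {a..b} \<Longrightarrow> y \<in> {a..b} \<Longrightarrow> dist y x < r \<Longrightarrow> dist (F y) (F x) < d"
    using d unfolding uniformly_continuous_on_def by meson
  have int: "(\<lambda>x. F x * g' x) integrable_on {u..v}" "g' integrable_on {u..v}" for u v
    by (intro integrable_continuous_real continuous_intros c[OF F] c[OF g'])+
  show "\<exists>\<gamma>. gauge \<gamma> \<and> (\<forall>p. p tagged_division_of {a..b} \<and> \<gamma> fine p \<longrightarrow>
      \<bar>(\<Sum>(x,K)\<in>p. F x * (g (Sup K) - g (Inf K))) - integral {a..b} (\<lambda>x. F x * g' x)\<bar> < e)"
  proof (intro exI[of _ "\<lambda>x. ball x r"] conjI allI impI gauge_ball r(1), elim conjE)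
    fix p assume p: "p tagged_division_of {a..b}" and fine: "(\<lambda>x. ball x r) fine p"
    have piece: "\<bar>F x * (g (Sup K) - g (Inf K)) - integral K (\<lambda>x. F x * g' x)\<bar> \<le> d * M * measure lborel K"
      if xK: "(x, K) \<in> p" for x K
    proof -
      from p xK obtain u v where K: "K = {u..v}" by (metis tagged_division_ofD(4) box_real(2))
      have x: "x \<in> K" and sub: "K \<subseteq> {a..b}" using p xK by (auto dest: tagged_division_ofD)
      then have uv: "u \<le> v" using K by auto
      have "K \<subseteq> ball x r" using fine xK by (auto simp: fine_def)
      have ftc: "(g' has_integral (g v - g u)) {u..v}"
        using g uv by (intro fundamental_theorem_of_calculus)
          (auto simp: has_real_derivative_iff_has_vector_derivative[symmetric] intro: has_field_derivative_at_within)
      have "F x * (g (Sup K) - g (Inf K)) - integral K (\<lambda>x. F x * g' x) = integral {u..v} (\<lambda>y. (F x - F y) * g' y)"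
        using integral_unique[OF ftc] int[of u v] uv
        by (simp add: K left_diff_distrib Henstock_Kurzweil_Integration.integral_diff integrable_on_mult_right)
      also have "\<bar>\<dots>\<bar> \<le> integral {u..v} (\<lambda>y. d * M)"
        unfolding real_norm_def[symmetric]
      proof (rule integral_norm_bound_integral)
        show "(\<lambda>y. (F x - F y) * g' y) integrable_on {u..v}"
          by (intro integrable_continuous_real continuous_intros c[OF F] c[OF g'])
        fix y assume y: "y \<in> {u..v}"
        have "dist y x < r" using \<open>K \<subseteq> ball x r\<close> y K by (auto simp: dist_commute)
        then have "dist (F y) (F x) < d" using x sub y K by (intro r) auto
        then show "norm ((F x - F y) * g' y) \<le> d * M"
          unfolding norm_mult using M(2)[of y] sub K y d
          by (intro mult_mono) (auto simp: dist_norm abs_minus_commute)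
      qed auto
      also have "\<dots> = d * M * measure lborel K" using uv by (simp add: K)
      finally show ?thesis .
    qed
    have "(\<Sum>(x,K)\<in>p. integral K (\<lambda>x. F x * g' x)) = integral {a..b} (\<lambda>x. F x * g' x)"
      using integral_combine_tagged_division_topdown[of "\<lambda>x. F x * g' x" a b p] int p by simp
    then have "\<bar>(\<Sum>(x,K)\<in>p. F x * (g (Sup K) - g (Inf K))) - integral {a..b} (\<lambda>x. F x * g' x)\<bar>
      = \<bar>\<Sum>(x,K)\<in>p. F x * (g (Sup K) - g (Inf K)) - integral K (\<lambda>x. F x * g' x)\<bar>"
      by (simp add: case_prod_unfold sum_subtractf)
    also have "\<dots> \<le> (\<Sum>(x,K)\<in>p. d * M * measure lborel K)"
      by (rule order_trans[OF sum_abs], rule sum_mono) (use piece in auto)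
    also have "\<dots> = d * M * (\<Sum>(x,K)\<in>p. measure lborel K)"
      by (simp add: sum_distrib_left case_prod_unfold)
    also have "(\<Sum>(x,K)\<in>p. measure lborel K) = b - a"
      using additive_content_tagged_division[of p a b] p ab by simp
    also have "d * M * (b - a) = e / 2 * ((b - a) / (b - a + 1))"
      using M(1) by (simp add: d_def)
    also have "\<dots> \<le> e / 2 * 1" using e ab by (intro mult_left_mono) auto
    also have "\<dots> < e" using e by simp
    finally show "\<bar>(\<Sum>(x,K)\<in>p. F x * (g (Sup K) - g (Inf K))) - integral {a..b} (\<lambda>x. F x * g' x)\<bar> < e" .
  qed
qed

text \<open>The integral over any interval containing a large ball is close to the full integral,
  whatever its two endpoints. This is the independent motion of both endpoints that the product
  filter demands.\<close>

lemma hs_has_integral_R_C1: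
  assumes F: "continuous_on UNIV F"
    and g: "\<And>x. (g has_real_derivative g' x) (at x)" and g': "continuous_on UNIV g'"
    and int: "integrable lborel (\<lambda>x. F x * g' x)"
  shows "hs_has_integral_R F g (LINT x|lborel. F x * g' x)"
proof -
  note on = hs_has_integral_on_C1[OF F g g']
  have eq: "hs_integral_on F g a b = integral {a..b} (\<lambda>x. F x * g' x)" if "a \<le> b" for a b
    unfolding hs_integral_on_def using on[OF that] hs_has_integral_on_unique by blast
  have "((\<lambda>x. F x * g' x) has_integral (LINT x|lborel. F x * g' x)) UNIV"
    by (rule has_integral_integral_lborel[OF int])
  note alt = this[unfolded has_integral_alt'[of _ _ UNIV], simplified]
  have "((\<lambda>(a, b). hs_integral_on F g a b) \<longlongrightarrow> (LINT x|lborel. F x * g' x)) (at_bot \<times>\<^sub>F at_top)"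
  proof (rule tendstoI)
    fix e :: real assume "e > 0"
    with alt obtain B where B: "B > 0" "\<And>a b. ball 0 B \<subseteq> {a..b} \<Longrightarrow>
        norm (integral {a..b} (\<lambda>x. F x * g' x) - (LINT x|lborel. F x * g' x)) < e"
      by auto
    have "eventually (\<lambda>a. a \<le> - B) at_bot" "eventually (\<lambda>b. b \<ge> B) at_top"
      by (rule eventually_le_at_bot eventually_ge_at_top)+
    from eventually_prodI[OF this] show "eventually (\<lambda>x. dist (case x of (a, b) \<Rightarrow> hs_integral_on F g a b) (LINT x|lborel. F x * g' x) < e) (at_bot \<times>\<^sub>F at_top)"
    proof eventually_elim
      case (elim p)
      obtain a b where p: "p = (a, b)" by (cases p)
      with elim have "a \<le> - B" "b \<ge> B" by auto
      moreover from this have "ball 0 B \<subseteq> {a..b}" by (auto simp: dist_norm)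
      ultimately show ?case using B by (simp add: p eq dist_norm)
    qed
  qed
  with on show ?thesis unfolding hs_has_integral_R_def by blast
qed

lemma hs_has_integral_R_imp_eq:
  assumes "hs_has_integral_R F g I" shows "hs_integral_R F g = I"
proof -
  have "(at_bot :: real filter) \<times>\<^sub>F (at_top :: real filter) \<noteq> bot"
    by (simp add: prod_filter_eq_bot)
  then show ?thesis using assms
    unfolding hs_integral_R_def hs_has_integral_R_def by (auto intro!: the_equality tendsto_unique)
qed

section \<open>Convolution with the heat kernel\<close>

lemma heat_kernel_tendsto_at_top: "t > 0 \<Longrightarrow> (heat_kernel t \<longlongrightarrow> 0) at_top"
  unfolding heat_kernel_def[abs_def] by real_asymp

lemma heat_kernel_reflected_tendsto: "t > 0 \<Longrightarrow> ((\<lambda>\<xi>. heat_kernel t (x - \<xi>)) \<longlongrightarrow> 0) at_top"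
  unfolding heat_kernel_def[abs_def] by real_asymp

lemma continuous_on_heat_kernel: "t > 0 \<Longrightarrow> continuous_on S (heat_kernel t)"
  by (rule continuous_at_imp_continuous_on) (blast intro: DERIV_isCont heat_kernel_has_derivative)

text \<open>The reflection in \<open>x - \<xi>\<close> makes the derivative of the integrator
  positive multiples of \<open>x - \<xi>\<close>; the minus sign in \<open>conv_heat_eq\<close>
  comes from the pairing.\<close>

lemma hs_has_integral_R_heat_kernel:
  assumes F: "F \<in> BC" and t: "t > 0"
  shows "hs_has_integral_R F (\<lambda>\<xi>. heat_kernel t (x - \<xi>)) (heat_moment F 1 t x / (2 * t))"
proof -
  have eq: "F \<xi> * ((x - \<xi>) / (2 * t) * heat_kernel t (x - \<xi>)) =
    1 / (2 * t) * (F \<xi> * (x - \<xi>) ^ 1 * heat_kernel t (x - \<xi>))" for \<xi> by simp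
  have "hs_has_integral_R F (\<lambda>\<xi>. heat_kernel t (x - \<xi>))
      (LINT \<xi>|lborel. F \<xi> * ((x - \<xi>) / (2 * t) * heat_kernel t (x - \<xi>)))"
  proof (rule hs_has_integral_R_C1)
    show "continuous_on UNIV F" using F by (simp add: BC_def)
    show "continuous_on UNIV (\<lambda>\<xi>. (x - \<xi>) / (2 * t) * heat_kernel t (x - \<xi>))"
      using t by (intro continuous_intros continuous_on_compose2[OF continuous_on_heat_kernel[of t UNIV]]) auto
    show "((\<lambda>\<xi>. heat_kernel t (x - \<xi>)) has_real_derivative (x - \<xi>) / (2 * t) * heat_kernel t (x - \<xi>)) (at \<xi>)" for \<xi>
    proof -
      have "((\<lambda>\<xi>. x - \<xi>) has_real_derivative - 1) (at \<xi>)" by (auto intro!: derivative_eq_intros)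
      from DERIV_chain2[where g = "\<lambda>\<xi>. x - \<xi>", OF heat_kernel_has_derivative[OF t] this]
      show ?thesis by (simp add: field_simps)
    qed
    show "integrable lborel (\<lambda>\<xi>. F \<xi> * ((x - \<xi>) / (2 * t) * heat_kernel t (x - \<xi>)))"
      unfolding eq by (intro integrable_mult_right integrable_heat_moment_kernel F t)
  qed
  also have "(LINT \<xi>|lborel. F \<xi> * ((x - \<xi>) / (2 * t) * heat_kernel t (x - \<xi>))) = heat_moment F 1 t x / (2 * t)"
    unfolding eq heat_moment_def by simp
  finally show ?thesis .
qed

text \<open>The boundary term of the pairing carries the limit of the kernel at infinity, which is
  0, so the Stieltjes integral alone survives.\<close>

lemma conv_heat_eq:
  assumes F: "F \<in> BC" and t: "t > 0"
  shows "conv_heat F t x = - heat_moment F 1 t x / (2 * t)"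
  unfolding conv_heat_def ac_pair_def
  by (simp add: hs_has_integral_R_imp_eq[OF hs_has_integral_R_heat_kernel[OF assms]] at_pinf_eq[OF heat_kernel_reflected_tendsto[OF t]])

lemma conv_heat_scaled:
  assumes F: "F \<in> BC" and t: "t > 0"
  shows "conv_heat F t x = - (LINT w|lborel. F (x - sqrt t * w) * (w * heat_kernel 1 w)) / (2 * sqrt t)"
proof -
  have "sqrt t / (2 * t) = 1 / (2 * sqrt t)" using t real_sqrt_mult_self[of t] by (simp add: field_simps)
  then have eq: "sqrt t * c / (2 * t) = c / (2 * sqrt t)" for c 
    by (metis mult.commute mult_1 times_divide_eq_right)
  show ?thesis using conv_heat_eq[OF assms, of x] heat_moment_scaled[OF assms, of 1 x]
    by (simp add: eq)
qed

lemma refl_prim_BC: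
  assumes "F \<in> BC" shows "refl_prim F x \<in> BC"
proof -
  obtain M where M: "\<And>x. \<bar>F x\<bar> \<le> M" using BC_bound[OF assms] by blast
  have "\<bar>at_pinf F - F (x - \<xi>)\<bar> \<le> \<bar>at_pinf F\<bar> + M" for \<xi>
    by (rule order_trans[OF abs_triangle_ineq4]) (simp add: M)
  moreover have "continuous_on UNIV (\<lambda>\<xi>. at_pinf F - F (x - \<xi>))"
    using assms by (intro continuous_on_diff continuous_on_const continuous_on_compose2[of UNIV F UNIV "\<lambda>\<xi>. x - \<xi>"] continuous_on_id)
      (auto simp: BC_def)
  ultimately show ?thesis unfolding refl_prim_def BC_def bounded_iff real_norm_def
    by (intro CollectI conjI exI[of _ "\<bar>at_pinf F\<bar> + M"] ballI) auto
qed

text \<open>As the kernel is even, this is the previous integral for the reflected primitive at the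
  point 0. Its constant \<open>at_pinf F\<close> is killed by the vanishing first moment, and its
  minus sign is cancelled by the substitution of \<open>- w\<close> for \<open>w\<close>.\<close>

lemma hs_has_integral_R_refl_prim:
  assumes F: "F \<in> BC" and t: "t > 0"
  shows "hs_has_integral_R (refl_prim F x) (heat_kernel t) (heat_moment F 1 t x / (2 * t))"
proof -
  let ?w = "\<lambda>w. w ^ 1 * heat_kernel 1 w"
  note s = integrable_scaled_moment[OF F, of x _ 1]
  have "(LINT w|lborel. refl_prim F x (0 - sqrt t * w) * ?w w) =
      (LINT w|lborel. at_pinf F * ?w w - F (x - (- sqrt t) * w) * ?w w)"
    by (simp add: refl_prim_def algebra_simps)
  also have "\<dots> = (LINT w|lborel. at_pinf F * ?w w) - (LINT w|lborel. F (x - (- sqrt t) * w) * ?w w)"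
    by (intro Bochner_Integration.integral_diff integrable_mult_right integrable_heat_moment s)
  also have "(LINT w|lborel. at_pinf F * ?w w) = 0"
    using integral_heat_moment_1 by simp
  also have "(LINT w|lborel. F (x - (- sqrt t) * w) * ?w w) = \<bar>-1\<bar> *\<^sub>R (LINT w|lborel. F (x - (- sqrt t) * (0 + (-1) * w)) * ?w (0 + (-1) * w))"
    by (rule lborel_integral_real_affine) simp
  also have "\<dots> = - (LINT w|lborel. F (x - sqrt t * w) * ?w w)"
    by simp
  finally have "heat_moment (refl_prim F x) 1 t 0 = heat_moment F 1 t x"
    using heat_moment_scaled[OF F t, of 1 x] heat_moment_scaled[OF refl_prim_BC[OF F] t, of x 1 0] by simp
  then show ?thesis
    using hs_has_integral_R_heat_kernel[OF refl_prim_BC[OF F] t, of x 0] by simp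
qed

lemma heat_conv_eq:
  assumes F: "F \<in> BC" and t: "t > 0"
  shows "heat_conv F t x = - heat_moment F 1 t x / (2 * t)"
  unfolding heat_conv_def ac_pair_def
  by (simp add: hs_has_integral_R_imp_eq[OF hs_has_integral_R_refl_prim[OF assms]] at_pinf_eq[OF heat_kernel_tendsto_at_top[OF t]])

lemma kernel_deriv_has_integral:
  assumes F: "F \<in> BC" and t: "t > 0"
  shows "((\<lambda>\<xi>. F \<xi> * deriv (heat_kernel t) (x - \<xi>)) has_integral - heat_moment F 1 t x / (2 * t)) UNIV"
proof -
  have "(\<lambda>\<xi>. F \<xi> * deriv (heat_kernel t) (x - \<xi>)) =
    (\<lambda>\<xi>. - 1 / (2 * t) * (F \<xi> * (x - \<xi>) ^ 1 * heat_kernel t (x - \<xi>)))"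
    using t by (simp add: deriv_heat_kernel fun_eq_iff field_simps)
  moreover have "((\<lambda>\<xi>. - 1 / (2 * t) * (F \<xi> * (x - \<xi>) ^ 1 * heat_kernel t (x - \<xi>))) has_integral
      - 1 / (2 * t) * heat_moment F 1 t x) UNIV"
    unfolding heat_moment_def
    by (intro has_integral_mult_right has_integral_integral_lborel integrable_heat_moment_kernel F t)
  ultimately show ?thesis by simp
qed

lemma kernel_has_integral:
  assumes F: "F \<in> BC" and t: "t > 0"
  shows "((\<lambda>\<xi>. F \<xi> * heat_kernel t (x - \<xi>)) has_integral heat_moment F 0 t x) UNIV"
  using has_integral_integral_lborel[OF integrable_heat_moment_kernel[OF F t, of x 0]]
  by (simp add: heat_moment_def)

lemma heat_moment_0_has_derivative:
  assumes F: "F \<in> BC" and t: "t > 0"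
  shows "(heat_moment F 0 t has_real_derivative conv_heat F t x) (at x)"
  using heat_moment_has_derivative_x[OF F t, of 0 x] by (simp add: conv_heat_eq[OF F t])

lemma conv_heat_representations:
  assumes F: "F \<in> BC" and t: "t > 0"
  shows "hs_integrable_R F (\<lambda>\<xi>. heat_kernel t (x - \<xi>)) \<and>
      hs_integrable_R (refl_prim F x) (heat_kernel t) \<and>
      (\<lambda>\<xi>. F \<xi> * deriv (heat_kernel t) (x - \<xi>)) integrable_on UNIV \<and>
      (\<lambda>\<xi>. F \<xi> * heat_kernel t (x - \<xi>)) integrable_on UNIV \<and>
      conv_heat F t x = heat_conv F t x \<and>
      heat_conv F t x = integral UNIV (\<lambda>\<xi>. F \<xi> * deriv (heat_kernel t) (x - \<xi>)) \<and>
      ((\<lambda>y. integral UNIV (\<lambda>\<xi>. F \<xi> * heat_kernel t (y - \<xi>)))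
         has_real_derivative conv_heat F t x) (at x)"
proof (intro conjI)
  show "hs_integrable_R F (\<lambda>\<xi>. heat_kernel t (x - \<xi>))" "hs_integrable_R (refl_prim F x) (heat_kernel t)"
    unfolding hs_integrable_R_def using hs_has_integral_R_heat_kernel[OF assms] hs_has_integral_R_refl_prim[OF assms] by blast+
  show "(\<lambda>\<xi>. F \<xi> * deriv (heat_kernel t) (x - \<xi>)) integrable_on UNIV"
    "(\<lambda>\<xi>. F \<xi> * heat_kernel t (x - \<xi>)) integrable_on UNIV"
    using kernel_deriv_has_integral[OF assms] kernel_has_integral[OF assms] by blast+
  show "conv_heat F t x = heat_conv F t x"
    by (simp add: conv_heat_eq[OF assms] heat_conv_eq[OF assms])
  show "heat_conv F t x = integral UNIV (\<lambda>\<xi>. F \<xi> * deriv (heat_kernel t) (x - \<xi>))"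
    by (simp add: heat_conv_eq[OF assms] integral_unique[OF kernel_deriv_has_integral[OF assms]])
  show "((\<lambda>y. integral UNIV (\<lambda>\<xi>. F \<xi> * heat_kernel t (y - \<xi>))) has_real_derivative conv_heat F t x) (at x)"
    using heat_moment_0_has_derivative[OF assms, of x] by (simp add: integral_unique[OF kernel_has_integral[OF assms]])
qed

section \<open>Norm estimates and limits\<close>

lemma alex_upper:
  assumes "F \<in> BC" shows "\<bar>F y - F x\<bar> \<le> alex F"
proof -
  obtain M where M: "\<And>x. \<bar>F x\<bar> \<le> M" using BC_bound[OF assms] by blast
  have bdd: "bdd_above {\<bar>F y - F x\<bar> |x y. x < y}"
  proof (rule bdd_aboveI)
    fix z assume "z \<in> {\<bar>F y - F x\<bar> |x y. x < y}"
    then obtain x y where z: "z = \<bar>F y - F x\<bar>" by blast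
    show "z \<le> M + M" unfolding z
      by (rule order_trans[OF abs_triangle_ineq4]) (intro add_mono M)
  qed
  have less: "\<bar>F y - F x\<bar> \<le> alex F" if "x < y" for x y
    unfolding alex_def by (rule cSup_upper[OF _ bdd]) (use that in blast)
  have "0 \<le> alex F" by (rule order_trans[OF abs_ge_zero less[of 0 1]]) simp
  then show ?thesis using less[of x y] less[of y x]
    by (cases x y rule: linorder_cases) (auto simp: abs_minus_commute)
qed

lemma alex_nonneg: "F \<in> BC \<Longrightarrow> 0 \<le> alex F"
  using alex_upper[of F 0 0] by simp

lemma alex_least:
  assumes "\<And>x y. x < y \<Longrightarrow> \<bar>F y - F x\<bar> \<le> c" shows "alex F \<le> c"
  unfolding alex_def
proof (rule cSup_least)
  have "\<bar>F 1 - F 0\<bar> \<in> {\<bar>F y - F x\<bar> |x y. x < y}" by (intro CollectI exI[of _ 0] exI[of _ 1]) auto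
  then show "{\<bar>F y - F x\<bar> |x y. x < y} \<noteq> {}" by blast
qed (use assms in blast)

text \<open>All values of \<open>F\<close> lie in the interval of length \<open>alex F\<close> that
  ends at their supremum; \<open>m\<close> is its midpoint.\<close>

lemma alex_midrange:
  assumes F: "F \<in> BC" obtains m where "\<And>x. \<bar>F x - m\<bar> \<le> alex F / 2"
proof -
  obtain M where M: "\<And>x. \<bar>F x\<bar> \<le> M" using BC_bound[OF F] by blast
  have "- M \<le> F x" "F x \<le> M" for x using M[of x] by auto
  then have bdd: "bdd_above (range F)" "bdd_below (range F)" by (auto intro!: bdd_aboveI bdd_belowI)
  have "Sup (range F) - alex F \<le> F x" for x
  proof -
    have "Sup (range F) \<le> F x + alex F"
    proof (rule cSup_least)
      fix z assume "z \<in> range F"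
      then obtain y where "z = F y" by blast
      then show "z \<le> F x + alex F" using alex_upper[OF F, of y x] by (simp add: abs_le_iff)
    qed simp
    then show ?thesis by simp
  qed
  then have *: "Sup (range F) - alex F \<le> F x" "F x \<le> Sup (range F)" for x
    using cSup_upper[OF _ bdd(1)] by auto
  have "\<bar>F x - (Sup (range F) - alex F / 2)\<bar> \<le> alex F / 2" for x
    unfolding abs_le_iff using *[of x] by (simp add: field_simps)
  then show ?thesis by (rule that)
qed

lemma conv_heat_bound:
  assumes F: "F \<in> BC" and t: "t > 0"
  shows "\<bar>conv_heat F t x\<bar> \<le> alex F / (2 * sqrt (pi * t))"
proof -
  obtain m where m: "\<And>x. \<bar>F x - m\<bar> \<le> alex F / 2" using alex_midrange[OF F] by blast
  have mint: "integrable lborel (\<lambda>w. m * (w * heat_kernel 1 w))"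
    using integrable_heat_moment[of 1] by simp
  have Fint: "integrable lborel (\<lambda>w. F (x - sqrt t * w) * (w * heat_kernel 1 w))"
    using integrable_scaled_moment[OF F, of x "sqrt t" 1] by simp
  have "(LINT w|lborel. F (x - sqrt t * w) * (w * heat_kernel 1 w)) =
     (LINT w|lborel. (F (x - sqrt t * w) - m) * (w * heat_kernel 1 w))"
    unfolding left_diff_distrib Bochner_Integration.integral_diff[OF Fint mint]
    using integral_heat_moment_1 by simp
  also have "\<bar>\<dots>\<bar> \<le> (LINT w|lborel. alex F / 2 * (\<bar>w\<bar> * heat_kernel 1 w))"
  proof (rule integral_abs_bound_integral)
    show "integrable lborel (\<lambda>w. (F (x - sqrt t * w) - m) * (w * heat_kernel 1 w))"
      unfolding left_diff_distrib by (intro Bochner_Integration.integrable_diff Fint mint)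
    show "integrable lborel (\<lambda>w. alex F / 2 * (\<bar>w\<bar> * heat_kernel 1 w))"
      using integrable_heat_moment_abs[of 1] by simp
    show "\<bar>(F (x - sqrt t * w) - m) * (w * heat_kernel 1 w)\<bar> \<le> alex F / 2 * (\<bar>w\<bar> * heat_kernel 1 w)" for w
      using mult_right_mono[OF m[of "x - sqrt t * w"], of "\<bar>w\<bar> * heat_kernel 1 w"] by (simp add: abs_mult)
  qed
  also have "\<dots> = alex F / sqrt pi" by (simp add: integral_heat_moment_abs_1 del: times_divide_eq_left)
  finally have "\<bar>LINT w|lborel. F (x - sqrt t * w) * (w * heat_kernel 1 w)\<bar> / (2 * sqrt t) \<le> alex F / sqrt pi / (2 * sqrt t)"
    using t by (intro divide_right_mono) auto
  then show ?thesis unfolding conv_heat_scaled[OF F t] using t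
    by (simp add: real_sqrt_mult mult_ac)
qed

lemma sup_norm_upper:
  assumes "\<And>x. \<bar>u x\<bar> \<le> c" shows "\<bar>u x\<bar> \<le> sup_norm u"
  unfolding sup_norm_def by (rule cSup_upper) (use assms in \<open>auto intro!: bdd_aboveI\<close>)

lemma sup_norm_least:
  assumes "\<And>x. \<bar>u x\<bar> \<le> c" shows "sup_norm u \<le> c"
  unfolding sup_norm_def by (rule cSup_least) (use assms in auto)

section \<open>Limits of the convolutions at both ends of the line\<close>

lemma scaled_moment_tendsto_at_top:
  assumes F: "F \<in> BC" and l: "(F \<longlongrightarrow> l) at_top"
  shows "((\<lambda>x. LINT w|lborel. F (x - s * w) * (w ^ k * heat_kernel 1 w)) \<longlongrightarrow>
     l * (LINT w|lborel. w ^ k * heat_kernel 1 w)) at_top"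
proof -
  note [measurable] = BC_measurable[OF F]
  obtain M where M: "\<And>x. \<bar>F x\<bar> \<le> M" "M \<ge> 0" using BC_bound[OF F] by blast
  have "((\<lambda>x. LINT w|lborel. F (x - s * w) * (w ^ k * heat_kernel 1 w)) \<longlongrightarrow>
     (LINT w|lborel. l * (w ^ k * heat_kernel 1 w))) at_top"
  proof (rule integral_dominated_convergence_at_top)
    show "integrable lborel (\<lambda>w. M * (\<bar>w\<bar> ^ k * heat_kernel 1 w))"
      by (intro integrable_mult_right integrable_heat_moment_abs)
    show "\<forall>\<^sub>F x in at_top. AE w in lborel. norm (F (x - s * w) * (w ^ k * heat_kernel 1 w))
            \<le> M * (\<bar>w\<bar> ^ k * heat_kernel 1 w)"
      by (intro always_eventually allI AE_I2) (auto simp: abs_mult power_abs intro!: mult_right_mono M)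
    show "AE w in lborel. ((\<lambda>x. F (x - s * w) * (w ^ k * heat_kernel 1 w)) \<longlongrightarrow> l * (w ^ k * heat_kernel 1 w)) at_top"
    proof (intro AE_I2 tendsto_mult_right)
      fix w
      have "filterlim (\<lambda>x. - (s * w) + x) at_top at_top"
        by (rule filterlim_tendsto_add_at_top[OF tendsto_const filterlim_ident])
      from filterlim_compose[OF l this] show "((\<lambda>x. F (x - s * w)) \<longlongrightarrow> l) at_top"
        by simp
    qed
  qed auto
  then show ?thesis by simp
qed

lemma scaled_moment_tendsto_at_bot:
  assumes F: "F \<in> BC" and l: "(F \<longlongrightarrow> l) at_bot"
  shows "((\<lambda>x. LINT w|lborel. F (x - s * w) * (w ^ k * heat_kernel 1 w)) \<longlongrightarrow>
     l * (LINT w|lborel. w ^ k * heat_kernel 1 w)) at_bot"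
proof -
  have "continuous_on UNIV (\<lambda>x. F (- x))"
    using F by (intro continuous_on_compose2[of UNIV F UNIV uminus] continuous_intros) (auto simp: BC_def)
  moreover have "bounded (range (\<lambda>x. F (- x)))"
    using F by (auto simp: BC_def elim!: bounded_subset)
  ultimately have BC: "(\<lambda>x. F (- x)) \<in> BC" by (simp add: BC_def)
  have "((\<lambda>x. F (- x)) \<longlongrightarrow> l) at_top" using l by (simp add: filterlim_at_bot_mirror)
  \<comment> \<open>Reflecting the line is compensated by the sign of \<open>s\<close>: the argument
    \<open>- (x - (- s) * w)\<close> equals \<open>- x - s * w\<close>, so \<open>w\<close> need not
    be substituted.\<close>
  from scaled_moment_tendsto_at_top[OF BC this, of "- s" k] show ?thesis
    by (simp add: filterlim_at_bot_mirror algebra_simps)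
qed

text \<open>The limit of \<open>F\<close> is multiplied by the first moment of the kernel, which is
  0; hence decay also where \<open>at_pinf F\<close> is nonzero.\<close>

lemma conv_heat_tendsto:
  assumes F: "F \<in> Bc" and t: "t > 0"
  shows "(conv_heat F t \<longlongrightarrow> 0) at_top" "(conv_heat F t \<longlongrightarrow> 0) at_bot" "(conv_heat F t \<longlongrightarrow> 0) at_infinity"
proof -
  note B = Bc_imp_BC[OF F]
  have eq: "conv_heat F t = (\<lambda>x. - (LINT w|lborel. F (x - sqrt t * w) * (w ^ 1 * heat_kernel 1 w)) / (2 * sqrt t))"
    by (simp add: conv_heat_scaled[OF B t] fun_eq_iff)
  have z: "l * (LINT w|lborel. w ^ 1 * heat_kernel 1 w) = 0" for l using integral_heat_moment_1 by simp
  have d: "(g \<longlongrightarrow> 0) A \<Longrightarrow> ((\<lambda>x. - g x / (2 * sqrt t)) \<longlongrightarrow> 0) A" for A and g :: "real \<Rightarrow> real"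
    using tendsto_divide[OF tendsto_minus tendsto_const, of g 0 A "2 * sqrt t"] t by simp
  show 1: "(conv_heat F t \<longlongrightarrow> 0) at_top"
    unfolding eq by (rule d) (use scaled_moment_tendsto_at_top[OF B Bc_tendsto(1)[OF F], of "sqrt t" 1] in \<open>simp only: z\<close>)
  show 2: "(conv_heat F t \<longlongrightarrow> 0) at_bot"
    unfolding eq by (rule d) (use scaled_moment_tendsto_at_bot[OF B Bc_tendsto(2)[OF F], of "sqrt t" 1] in \<open>simp only: z\<close>)
  show "(conv_heat F t \<longlongrightarrow> 0) at_infinity"
    unfolding at_infinity_eq_at_top_bot by (rule filterlim_sup[OF 1 2])
qed

lemma heat_moment_0_scaled:
  "F \<in> BC \<Longrightarrow> t > 0 \<Longrightarrow> heat_moment F 0 t x = (LINT w|lborel. F (x - sqrt t * w) * heat_kernel 1 w)"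
  using heat_moment_scaled[of F t 0 x] by simp

text \<open>The kernel has total mass 1, so the limits of \<open>F\<close> are preserved. This is
  also what preserves the total integral of \<open>f\<close>.\<close>

lemma heat_moment_0_tendsto:
  assumes F: "F \<in> Bc" and t: "t > 0"
  shows "(heat_moment F 0 t \<longlongrightarrow> at_pinf F) at_top" "(heat_moment F 0 t \<longlongrightarrow> 0) at_bot"
proof -
  note B = Bc_imp_BC[OF F]
  show "(heat_moment F 0 t \<longlongrightarrow> at_pinf F) at_top"
    using scaled_moment_tendsto_at_top[OF B Bc_tendsto(1)[OF F], of "sqrt t" 0]
    by (simp add: heat_moment_0_scaled[OF B t, abs_def] integral_heat_kernel)
  show "(heat_moment F 0 t \<longlongrightarrow> 0) at_bot"
    using scaled_moment_tendsto_at_bot[OF B Bc_tendsto(2)[OF F], of "sqrt t" 0]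
    by (simp add: heat_moment_0_scaled[OF B t, abs_def] integral_heat_kernel)
qed

section \<open>The primitive of the convolution and its Alexiewicz norm\<close>

lemma heat_moment_0_Bc:
  assumes F: "F \<in> Bc" and t: "t > 0" shows "heat_moment F 0 t \<in> Bc"
proof -
  have "continuous_on UNIV (heat_moment F 0 t)"
    by (rule continuous_at_imp_continuous_on)
       (blast intro: DERIV_isCont heat_moment_0_has_derivative[OF Bc_imp_BC[OF F] t])
  with heat_moment_0_tendsto[OF assms] show ?thesis by (auto simp: Bc_def Cbar_def)
qed

lemma is_prim_of_conv_heat:
  assumes F: "F \<in> Bc" and t: "t > 0" shows "is_prim_of (heat_moment F 0 t) (conv_heat F t)"
  unfolding is_prim_of_def
proof (intro conjI allI impI heat_moment_0_Bc[OF assms] fundamental_theorem_of_calculus)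
  show "(heat_moment F 0 t has_vector_derivative conv_heat F t x) (at x within S)" for x S
    unfolding has_real_derivative_iff_has_vector_derivative[symmetric]
    by (rule has_field_derivative_at_within[OF heat_moment_0_has_derivative[OF Bc_imp_BC[OF F] t]])
qed

text \<open>Equal increments leave a constant difference, and its limit at minus infinity is 0. This
  gives the definite description \<open>Ac_prim\<close> its value.\<close>

lemma is_prim_of_unique:
  assumes "is_prim_of G u" "is_prim_of H u" shows "G = H"
proof
  fix b
  have *: "G b - H b = G a - H a" if "a \<le> b" for a
  proof -
    have "(u has_integral (G b - G a)) {a..b}" "(u has_integral (H b - H a)) {a..b}"
      using assms that by (auto simp: is_prim_of_def)
    then have "G b - G a = H b - H a" by (rule has_integral_unique)
    then show ?thesis by simp
  qed
  have "((\<lambda>a. G a - H a) \<longlongrightarrow> 0 - 0) at_bot"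
    using assms by (intro tendsto_diff Bc_tendsto) (auto simp: is_prim_of_def)
  moreover have "eventually (\<lambda>a. G a - H a = G b - H b) at_bot"
    using eventually_le_at_bot[of b] by eventually_elim (simp add: *)
  ultimately have "((\<lambda>a::real. G b - H b) \<longlongrightarrow> 0 - 0) at_bot"
    by (rule Lim_transform_eventually)
  then show "G b = H b" by (simp add: tendsto_const_iff)
qed

lemma Ac_prim_conv_heat:
  assumes F: "F \<in> Bc" and t: "t > 0" shows "Ac_prim (conv_heat F t) = heat_moment F 0 t"
  unfolding Ac_prim_def using is_prim_of_conv_heat[OF assms] is_prim_of_unique by blast

text \<open>An increment of the smoothed primitive is an average of increments of \<open>F\<close>
  against a probability density.\<close>

lemma alex_heat_moment_0:
  assumes F: "F \<in> BC" and t: "t > 0" shows "alex (heat_moment F 0 t) \<le> alex F"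
proof (rule alex_least)
  fix x y :: real
  have int: "integrable lborel (\<lambda>w. F (x - sqrt t * w) * heat_kernel 1 w)" for x
    using integrable_scaled_moment[OF F, of x "sqrt t" 0] by simp
  have "heat_moment F 0 t y - heat_moment F 0 t x =
    (LINT w|lborel. (F (y - sqrt t * w) - F (x - sqrt t * w)) * heat_kernel 1 w)"
    unfolding left_diff_distrib Bochner_Integration.integral_diff[OF int int] heat_moment_0_scaled[OF assms] ..
  also have "\<bar>\<dots>\<bar> \<le> (LINT w|lborel. alex F * heat_kernel 1 w)"
  proof (rule integral_abs_bound_integral)
    show "integrable lborel (\<lambda>w. (F (y - sqrt t * w) - F (x - sqrt t * w)) * heat_kernel 1 w)"
      unfolding left_diff_distrib by (intro Bochner_Integration.integrable_diff int)
    show "integrable lborel (\<lambda>w. alex F * heat_kernel 1 w)"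
      using integrable_heat_moment[of 0] by simp
    show "\<bar>(F (y - sqrt t * w) - F (x - sqrt t * w)) * heat_kernel 1 w\<bar> \<le> alex F * heat_kernel 1 w" for w
      unfolding abs_mult using alex_upper[OF F] by (simp add: mult_right_mono)
  qed
  also have "\<dots> = alex F" by (simp add: integral_heat_kernel)
  finally show "\<bar>heat_moment F 0 t y - heat_moment F 0 t x\<bar> \<le> alex F" .
qed

text \<open>The total increment is the limit of \<open>F x - F (- x)\<close>. It supplies the lower
  bounds for the norms of the ramps, before and after smoothing.\<close>

lemma at_pinf_le_alex:
  assumes F: "F \<in> Bc" shows "at_pinf F \<le> alex F"
proof (rule tendsto_upperbound)
  show "((\<lambda>x. F x - F (- x)) \<longlongrightarrow> at_pinf F) at_top"
    using tendsto_diff[OF Bc_tendsto(1)[OF F] Bc_tendsto(2)[OF F, unfolded filterlim_at_bot_mirror]] by simp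
  show "eventually (\<lambda>x. F x - F (- x) \<le> alex F) at_top"
    using alex_upper[OF Bc_imp_BC[OF F]] by (intro always_eventually allI) (simp add: abs_le_iff)
qed simp

lemma BC_linear:
  assumes "G \<in> BC" "H \<in> BC" shows "(\<lambda>x. a * G x + b * H x) \<in> BC"
proof -
  obtain M where M: "\<And>x. \<bar>G x\<bar> \<le> M" "M \<ge> 0" using BC_bound[OF assms(1)] by blast
  obtain N where N: "\<And>x. \<bar>H x\<bar> \<le> N" "N \<ge> 0" using BC_bound[OF assms(2)] by blast
  have "norm (a * G x + b * H x) \<le> \<bar>a\<bar> * M + \<bar>b\<bar> * N" for x
    unfolding real_norm_def
    by (rule order_trans[OF abs_triangle_ineq]) (unfold abs_mult, intro add_mono mult_left_mono M N abs_ge_zero)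
  then have "bounded (range (\<lambda>x. a * G x + b * H x))"
    unfolding bounded_iff by (intro exI[of _ "\<bar>a\<bar> * M + \<bar>b\<bar> * N"] ballI) auto
  moreover have "continuous_on UNIV (\<lambda>x. a * G x + b * H x)"
    using assms unfolding BC_def by (intro continuous_on_add continuous_on_mult continuous_on_const) auto
  ultimately show ?thesis by (simp add: BC_def)
qed

lemma conv_heat_linear:
  assumes G: "G \<in> BC" and H: "H \<in> BC" and t: "t > 0"
  shows "conv_heat (\<lambda>x. a * G x + b * H x) t = (\<lambda>x. a * conv_heat G t x + b * conv_heat H t x)"
proof
  fix x
  let ?k = "\<lambda>F \<xi>. F \<xi> * (x - \<xi>) ^ 1 * heat_kernel t (x - \<xi>)"
  have "heat_moment (\<lambda>x. a * G x + b * H x) 1 t x = (LINT \<xi>|lborel. a * ?k G \<xi> + b * ?k H \<xi>)"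
    unfolding heat_moment_def by (simp add: algebra_simps)
  also have "\<dots> = a * heat_moment G 1 t x + b * heat_moment H 1 t x"
    unfolding heat_moment_def
    by (subst Bochner_Integration.integral_add) (auto intro!: integrable_mult_right integrable_heat_moment_kernel[of _ _ _ 1, simplified] assms)
  finally show "conv_heat (\<lambda>x. a * G x + b * H x) t x = a * conv_heat G t x + b * conv_heat H t x"
    using t by (simp add: conv_heat_eq[OF BC_linear[OF G H] t] conv_heat_eq[OF G t] conv_heat_eq[OF H t] field_simps)
qed

section \<open>Ramp primitives and the sharpness of both norm estimates\<close>

definition ramp :: "real \<Rightarrow> real \<Rightarrow> real" where
  "ramp d x = max 0 (min 1 (x / d))"

lemma ramp_props:
  assumes d: "d > 0"
  shows "ramp d \<in> Bc" "at_pinf (ramp d) = 1" "alex (ramp d) = 1"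
proof -
  have cont: "continuous_on UNIV (ramp d)" unfolding ramp_def by (intro continuous_intros) (use d in auto)
  have "eventually (\<lambda>x. ramp d x = 1) at_top"
    using eventually_ge_at_top[of d] by eventually_elim (use d in \<open>auto simp: ramp_def\<close>)
  then have top: "(ramp d \<longlongrightarrow> 1) at_top" by (rule tendsto_eventually)
  have "eventually (\<lambda>x. ramp d x = 0) at_bot"
    using eventually_le_at_bot[of 0] by eventually_elim (use d in \<open>auto simp: ramp_def divide_nonpos_pos\<close>)
  then have bot: "(ramp d \<longlongrightarrow> 0) at_bot" by (rule tendsto_eventually)
  from cont top bot show Bc: "ramp d \<in> Bc" by (auto simp: Bc_def Cbar_def)
  from top show pinf: "at_pinf (ramp d) = 1" by (rule at_pinf_eq)
  have "alex (ramp d) \<le> 1" by (rule alex_least) (auto simp: ramp_def)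
  with at_pinf_le_alex[OF Bc] pinf show "alex (ramp d) = 1" by simp
qed

lemma ramp_tendsto: "(\<lambda>n. ramp (1 / real (Suc n)) y) \<longlonglongrightarrow> (if y > 0 then 1 else 0)"
proof (cases "y > 0")
  case True
  then obtain N where N: "1 / real (Suc N) < y" using nat_approx_posE by metis
  have "ramp (1 / real (Suc n)) y = 1" if "n \<ge> N" for n
  proof -
    have "1 / real (Suc n) \<le> 1 / real (Suc N)" using that by (simp add: frac_le)
    with N have "1 / real (Suc n) \<le> y" by linarith
    then have "y / (1 / real (Suc n)) \<ge> 1" by (simp add: field_simps)
    then show ?thesis by (simp add: ramp_def)
  qed
  then have "eventually (\<lambda>n. ramp (1 / real (Suc n)) y = 1) sequentially"
    unfolding eventually_sequentially by blast
  then show ?thesis using True by (simp add: tendsto_eventually)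
next
  case False
  then have "y / (1 / real (Suc n)) \<le> 0" for n by (simp add: mult_nonpos_nonneg)
  then have "ramp (1 / real (Suc n)) y = 0" for n by (simp add: ramp_def min_le_iff_disj max_absorb1)
  then show ?thesis using False by simp
qed

text \<open>The Heaviside function is the primitive of the Dirac measure, whose convolution is the
  kernel itself; the limit is the peak \<open>heat_kernel t 0\<close>. Being discontinuous, it must
  be approximated from within \<open>Bc\<close>.\<close>

lemma conv_heat_ramp_tendsto:
  assumes t: "t > 0"
  shows "(\<lambda>n. conv_heat (ramp (1 / real (Suc n))) t 0) \<longlonglongrightarrow> 1 / (2 * sqrt (pi * t))"
proof -
  have B: "ramp (1 / real (Suc n)) \<in> BC" for n by (intro Bc_imp_BC ramp_props) simp
  let ?f = "\<lambda>w::real. (if - (sqrt t * w) > 0 then 1 else 0) * (w * heat_kernel 1 w)"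
  have "(\<lambda>n. LINT w|lborel. ramp (1 / real (Suc n)) (0 - sqrt t * w) * (w * heat_kernel 1 w)) \<longlonglongrightarrow> (LINT w|lborel. ?f w)"
  proof (rule integral_dominated_convergence)
    show "integrable lborel (\<lambda>w. \<bar>w\<bar> * heat_kernel 1 w)" using integrable_heat_moment_abs[of 1] by simp
    show "AE w in lborel. norm (ramp (1 / real (Suc n)) (0 - sqrt t * w) * (w * heat_kernel 1 w)) \<le> \<bar>w\<bar> * heat_kernel 1 w" for n
    proof (intro AE_I2)
      fix w
      have "\<bar>ramp (1 / real (Suc n)) (0 - sqrt t * w)\<bar> \<le> 1" by (simp add: ramp_def)
      from mult_right_mono[OF this, of "\<bar>w\<bar> * heat_kernel 1 w"]
      show "norm (ramp (1 / real (Suc n)) (0 - sqrt t * w) * (w * heat_kernel 1 w)) \<le> \<bar>w\<bar> * heat_kernel 1 w"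
        by (simp add: abs_mult)
    qed
    show "(\<lambda>w. ramp (1 / real (Suc n)) (0 - sqrt t * w) * (w * heat_kernel 1 w)) \<in> borel_measurable lborel" for n
      unfolding ramp_def by measurable
    show "AE w in lborel. (\<lambda>n. ramp (1 / real (Suc n)) (0 - sqrt t * w) * (w * heat_kernel 1 w)) \<longlonglongrightarrow> ?f w"
      by (intro AE_I2 tendsto_mult_right) (simp only: diff_0 ramp_tendsto)
  qed measurable
  \<comment> \<open>The indicator of \<open>w < 0\<close> times \<open>w\<close> is
    \<open>(w - \<bar>w\<bar>) / 2\<close>, which reduces the limit to the two known
    moments.\<close>
  also have "(LINT w|lborel. ?f w) = (LINT w|lborel. 1 / 2 * (w * heat_kernel 1 w - \<bar>w\<bar> * heat_kernel 1 w))"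
    using t by (intro Bochner_Integration.integral_cong refl) (auto simp: algebra_simps mult_less_0_iff)
  also have "\<dots> = 1 / 2 * ((LINT w|lborel. w * heat_kernel 1 w) - (LINT w|lborel. \<bar>w\<bar> * heat_kernel 1 w))"
    using integrable_heat_moment_abs[of 1] integrable_heat_moment[of 1] by simp
  also have "\<dots> = - 1 / sqrt pi" by (simp add: integral_heat_moment_1 integral_heat_moment_abs_1)
  finally have "(\<lambda>n. - (LINT w|lborel. ramp (1 / real (Suc n)) (0 - sqrt t * w) * (w * heat_kernel 1 w)) / (2 * sqrt t))
     \<longlonglongrightarrow> - (- 1 / sqrt pi) / (2 * sqrt t)"
    by (intro tendsto_intros) (use t in auto)
  then show ?thesis using t unfolding conv_heat_scaled[OF B t] by (simp add: real_sqrt_mult mult_ac)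
qed

lemma conv_heat_sharp:
  assumes t: "t > 0" and c: "c < 1 / (2 * sqrt (pi * t))"
  shows "\<exists>G\<in>Bc. alex G = 1 \<and> c < sup_norm (conv_heat G t)"
proof -
  from order_tendstoD(1)[OF conv_heat_ramp_tendsto[OF t] c]
  have "\<exists>n. c < conv_heat (ramp (1 / real (Suc n))) t 0"
    using eventually_happens'[OF sequentially_bot] by blast
  then obtain n where n: "c < conv_heat (ramp (1 / real (Suc n))) t 0" ..
  let ?G = "ramp (1 / real (Suc n))"
  have G: "?G \<in> Bc" "alex ?G = 1" by (simp_all add: ramp_props)
  from sup_norm_upper[of "conv_heat ?G t", OF conv_heat_bound[OF Bc_imp_BC[OF G(1)] t], of 0] n
  have "c < sup_norm (conv_heat ?G t)" by linarith
  with G show ?thesis by blast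
qed

text \<open>The contraction gives one bound; the other holds because smoothing keeps the total
  increment 1.\<close>

lemma alex_smoothed_ramp:
  assumes t: "t > 0" shows "alex (heat_moment (ramp 1) 0 t) = 1"
proof (rule antisym)
  note r = ramp_props[of 1, simplified]
  show "alex (heat_moment (ramp 1) 0 t) \<le> 1" using alex_heat_moment_0[OF Bc_imp_BC[OF r(1)] t] r by simp
  have "at_pinf (heat_moment (ramp 1) 0 t) = 1"
    using at_pinf_eq[OF heat_moment_0_tendsto(1)[OF r(1) t]] r by simp
  with at_pinf_le_alex[OF heat_moment_0_Bc[OF r(1) t]] show "1 \<le> alex (heat_moment (ramp 1) 0 t)" by simp
qed

section \<open>Smoothness and the heat equation\<close>

text \<open>All partial derivatives of the solution lie in the span of the functions
  \<open>t^(-m) * heat_moment F k t x\<close>, which is closed under both partial derivatives.\<close>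
inductive heat_span :: "(real \<Rightarrow> real) \<Rightarrow> (real \<times> real \<Rightarrow> real) \<Rightarrow> bool" for F where
  base: "heat_span F (\<lambda>(x, t). c * (1 / t) ^ m * heat_moment F k t x)"
| add: "heat_span F f \<Longrightarrow> heat_span F g \<Longrightarrow> heat_span F (\<lambda>p. f p + g p)"

lemma heat_span_continuous:
  assumes "heat_span F f" and F: "F \<in> BC"
  shows "continuous_on (UNIV \<times> {0<..}) f"
  using assms(1)
proof induction
  case (base c m k)
  have "continuous_on (UNIV \<times> {0<..}) (\<lambda>p::real \<times> real. c * (1 / snd p) ^ m * (case p of (x, t) \<Rightarrow> heat_moment F k t x))"
    by (intro continuous_intros continuous_on_heat_moment F) auto
  then show ?case by (simp add: case_prod_unfold)
qed (intro continuous_intros)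

text \<open>Derivatives are recorded by \<open>has_real_derivative\<close>, since
  \<open>deriv\<close> denotes a number even where no derivative exists.\<close>

definition has_pds :: "(real \<times> real \<Rightarrow> real) \<Rightarrow> (real \<times> real \<Rightarrow> real) \<Rightarrow> (real \<times> real \<Rightarrow> real) \<Rightarrow> bool" where
  "has_pds f g h \<longleftrightarrow> (\<forall>x. \<forall>t>0. ((\<lambda>y. f (y, t)) has_real_derivative g (x, t)) (at x) \<and>
     ((\<lambda>s. f (x, s)) has_real_derivative h (x, t)) (at t))"

text \<open>Both moment recursions combined with the derivative of \<open>(1 / t) ^ m\<close>. In
  \<open>real m + 1 / 2\<close> the half stems from the normalising root of the kernel.\<close>

lemma has_pds_base:
  assumes F: "F \<in> BC"
  shows "has_pds (\<lambda>(x, t). c * (1 / t) ^ m * heat_moment F k t x)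
    (\<lambda>p. (\<lambda>(x, t). c * real k * (1 / t) ^ m * heat_moment F (k - 1) t x) p
       + (\<lambda>(x, t). - c / 2 * (1 / t) ^ (m + 1) * heat_moment F (k + 1) t x) p)
    (\<lambda>p. (\<lambda>(x, t). c / 4 * (1 / t) ^ (m + 2) * heat_moment F (k + 2) t x) p
       + (\<lambda>(x, t). - c * (real m + 1 / 2) * (1 / t) ^ (m + 1) * heat_moment F k t x) p)"
  unfolding has_pds_def prod.case
proof (intro allI impI conjI)
  fix x t :: real assume t: "t > 0"
  define r where "r = 1 / t"
  have r: "A / (2 * t) = r / 2 * A" "A / (4 * t\<^sup>2) = r\<^sup>2 / 4 * A" for A
    by (simp_all add: r_def power2_eq_square)
  have "((\<lambda>y. c * r ^ m * heat_moment F k t y) has_real_derivative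
     c * r ^ m * (real k * heat_moment F (k - 1) t x - r / 2 * heat_moment F (k + 1) t x)) (at x)"
    using DERIV_cmult[OF heat_moment_has_derivative_x[OF F t]] unfolding r .
  also have "c * r ^ m * (real k * heat_moment F (k - 1) t x - r / 2 * heat_moment F (k + 1) t x) =
     c * real k * r ^ m * heat_moment F (k - 1) t x + - c / 2 * r ^ (m + 1) * heat_moment F (k + 1) t x"
    by (simp add: algebra_simps)
  finally show "((\<lambda>y. c * (1 / t) ^ m * heat_moment F k t y) has_real_derivative
     c * real k * (1 / t) ^ m * heat_moment F (k - 1) t x + - c / 2 * (1 / t) ^ (m + 1) * heat_moment F (k + 1) t x) (at x)"
    unfolding r_def .
  have inv: "((\<lambda>s. 1 / s) has_real_derivative - r\<^sup>2) (at t)"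
    using t by (auto intro!: derivative_eq_intros simp: r_def power2_eq_square)
  have "((\<lambda>s. (1 / s) ^ m) has_real_derivative - real m * r ^ (m + 1)) (at t)"
  proof (cases m)
    case (Suc n)
    have "((\<lambda>s. (1 / s) ^ Suc n) has_real_derivative real (Suc n) * (- r\<^sup>2 * (1 / t) ^ n)) (at t)"
      using DERIV_power[OF inv, of "Suc n"] by (simp del: of_nat_Suc)
    also have "real (Suc n) * (- r\<^sup>2 * (1 / t) ^ n) = - real (Suc n) * r ^ (Suc n + 1)"
      by (simp add: power2_eq_square r_def del: of_nat_Suc)
    finally show ?thesis unfolding Suc .
  qed simp
  from DERIV_mult[OF DERIV_cmult[OF this, of c] heat_moment_has_derivative_t[OF F t, of k x]]
  have "((\<lambda>s. c * (1 / s) ^ m * heat_moment F k s x) has_real_derivative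
     c * (- real m * r ^ (m + 1)) * heat_moment F k t x +
     (r\<^sup>2 / 4 * heat_moment F (k + 2) t x - r / 2 * heat_moment F k t x) * (c * r ^ m)) (at t)"
    unfolding r r_def[symmetric] .
  also have "c * (- real m * r ^ (m + 1)) * heat_moment F k t x +
     (r\<^sup>2 / 4 * heat_moment F (k + 2) t x - r / 2 * heat_moment F k t x) * (c * r ^ m) =
     c / 4 * r ^ (m + 2) * heat_moment F (k + 2) t x + - c * (real m + 1 / 2) * r ^ (m + 1) * heat_moment F k t x"
    by (simp add: power2_eq_square algebra_simps)
  finally show "((\<lambda>s. c * (1 / s) ^ m * heat_moment F k s x) has_real_derivative
     c / 4 * (1 / t) ^ (m + 2) * heat_moment F (k + 2) t x + - c * (real m + 1 / 2) * (1 / t) ^ (m + 1) * heat_moment F k t x) (at t)"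
    unfolding r_def .
qed

lemma heat_span_derivatives:
  assumes "heat_span F f" and F: "F \<in> BC"
  shows "\<exists>g h. heat_span F g \<and> heat_span F h \<and> has_pds f g h"
  using assms(1)
proof induction
  case (base c m k)
  show ?case
    \<comment> \<open>The third goal goes first: it determines both unknown derivatives, whose shape
      then matches \<open>heat_span.intros\<close>.\<close>
    by (intro exI conjI) (rule_tac [3] has_pds_base[OF F], (rule heat_span.intros)+)
next
  case (add f1 f2)
  then obtain g1 h1 g2 h2 where "heat_span F g1" "heat_span F h1" "has_pds f1 g1 h1"
    "heat_span F g2" "heat_span F h2" "has_pds f2 g2 h2" by blast
  then show ?case
    by (intro exI[of _ "\<lambda>p. g1 p + g2 p"] exI[of _ "\<lambda>p. h1 p + h2 p"] conjI heat_span.add)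
       (auto simp: has_pds_def intro!: DERIV_add)
qed

text \<open>The moment formulas hold for positive time only. Space derivatives at fixed
  \<open>t\<close> rewrite directly, whereas time derivatives need this locality.\<close>

lemma has_real_derivative_transform_pos:
  assumes "(f has_real_derivative D) (at t)" "t > 0" "\<And>s. s > 0 \<Longrightarrow> g s = f s"
  shows "(g has_real_derivative D) (at t)"
proof (rule has_field_derivative_transform_within_open[OF assms(1), of "{0<..}"])
  show "f s = g s" if "s \<in> {0<..}" for s using assms(3)[of s] that by simp
qed (use assms in auto)

lemma iter_pd_heat_span:
  assumes F: "F \<in> BC"
  shows "\<exists>f. heat_span F f \<and> (\<forall>x. \<forall>t>0. iter_pd bs (heat_u F) (x, t) = f (x, t))"
proof (induction bs)
  case Nil
  have "heat_span F (\<lambda>(x, t). - 1 / 2 * (1 / t) ^ 1 * heat_moment F 1 t x)" by (rule heat_span.base)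
  moreover have "heat_u F (x, t) = (\<lambda>(x, t). - 1 / 2 * (1 / t) ^ 1 * heat_moment F 1 t x) (x, t)" if "t > 0" for x t
    using that by (simp add: heat_u_def conv_heat_eq[OF F that])
  ultimately show ?case by auto
next
  case (Cons b bs)
  then obtain f where f: "heat_span F f" "\<And>x t. t > 0 \<Longrightarrow> iter_pd bs (heat_u F) (x, t) = f (x, t)" by blast
  obtain g h where gh: "heat_span F g" "heat_span F h"
    and g: "\<And>x t. t > 0 \<Longrightarrow> ((\<lambda>y. f (y, t)) has_real_derivative g (x, t)) (at x)"
    and h: "\<And>x t. t > 0 \<Longrightarrow> ((\<lambda>s. f (x, s)) has_real_derivative h (x, t)) (at t)"
    using heat_span_derivatives[OF f(1) F] unfolding has_pds_def by blast
  have "pd_x (iter_pd bs (heat_u F)) (x, t) = g (x, t)" if "t > 0" for x t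
    using DERIV_imp_deriv[OF g[OF that]] f(2)[OF that] by (simp add: pd_x_def)
  moreover have "pd_t (iter_pd bs (heat_u F)) (x, t) = h (x, t)" if "t > 0" for x t
    using DERIV_imp_deriv[OF has_real_derivative_transform_pos[OF h[OF that] that f(2)]] by (simp add: pd_t_def)
  ultimately show ?case using gh by (cases b) auto
qed

lemma C_infinity_heat_u:
  assumes F: "F \<in> BC"
  shows "C_infinity_on (UNIV \<times> {0<..}) (heat_u F)"
  unfolding C_infinity_on_def
proof (intro allI conjI ballI)
  fix bs
  obtain f where f: "heat_span F f" "\<And>x t. t > 0 \<Longrightarrow> iter_pd bs (heat_u F) (x, t) = f (x, t)"
    using iter_pd_heat_span[OF F] by blast
  show "continuous_on (UNIV \<times> {0<..}) (iter_pd bs (heat_u F))"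
    using heat_span_continuous[OF f(1) F] by (rule continuous_on_eq) (use f(2) in auto)
  obtain g h where g: "\<And>x t. t > 0 \<Longrightarrow> ((\<lambda>y. f (y, t)) has_real_derivative g (x, t)) (at x)"
    and h: "\<And>x t. t > 0 \<Longrightarrow> ((\<lambda>s. f (x, s)) has_real_derivative h (x, t)) (at t)"
    using heat_span_derivatives[OF f(1) F] unfolding has_pds_def by blast
  fix p :: "real \<times> real" assume "p \<in> UNIV \<times> {0<..}"
  then obtain x t where p: "p = (x, t)" and t: "t > 0" by auto
  have "(\<lambda>y. iter_pd bs (heat_u F) (y, t)) differentiable (at x)"
    unfolding real_differentiable_def f(2)[OF t] using g[OF t] by blast
  moreover have "(\<lambda>s. iter_pd bs (heat_u F) (x, s)) differentiable (at t)"
    unfolding real_differentiable_def using has_real_derivative_transform_pos[OF h[OF t] t f(2)] by blast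
  ultimately show "case p of (x, t) \<Rightarrow> (\<lambda>y. iter_pd bs (heat_u F) (y, t)) differentiable (at x) \<and>
      (\<lambda>s. iter_pd bs (heat_u F) (x, s)) differentiable (at t)" by (simp add: p)
qed

text \<open>Writing \<open>M1\<close> and \<open>M3\<close> for the moments of order 1 and 3, both
  sides equal \<open>3 * M1 / (4 * t^2) - M3 / (8 * t^3)\<close>.\<close>

lemma heat_equation:
  assumes F: "F \<in> BC" and t: "t > 0"
  shows "pd_t (heat_u F) (x, t) = pd_x (pd_x (heat_u F)) (x, t)"
proof -
  let ?h = "\<lambda>k. heat_moment F k t x"
  have u: "heat_u F (x, t) = - heat_moment F 1 t x / (2 * t)" if "t > 0" for x t
    using conv_heat_eq[OF F that] by (simp add: heat_u_def)
  have 1: "pd_x (heat_u F) (y, t) = - (heat_moment F 0 t y - heat_moment F 2 t y / (2 * t)) / (2 * t)" for y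
  proof -
    have "((\<lambda>y. - heat_moment F 1 t y / (2 * t)) has_real_derivative
       - (heat_moment F 0 t y - heat_moment F 2 t y / (2 * t)) / (2 * t)) (at y)"
      using DERIV_cdivide[OF DERIV_minus[OF heat_moment_has_derivative_x[OF F t, of 1 y]], of "2 * t"]
      by (simp flip: numeral_2_eq_2)
    from DERIV_imp_deriv[OF this] show ?thesis by (simp add: pd_x_def u[OF t])
  qed
  have "((\<lambda>y. - (heat_moment F 0 t y - heat_moment F 2 t y / (2 * t)) / (2 * t)) has_real_derivative
      - (- ?h 1 / (2 * t) - (2 * ?h 1 - ?h 3 / (2 * t)) / (2 * t)) / (2 * t)) (at x)"
    using DERIV_cdivide[OF DERIV_minus[OF DERIV_diff[OF heat_moment_has_derivative_x[OF F t, of 0 x]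
       DERIV_cdivide[OF heat_moment_has_derivative_x[OF F t, of 2 x], of "2 * t"]]], of "2 * t"]
    by (simp add: numeral_3_eq_3)
  from DERIV_imp_deriv[OF this]
  have 2: "pd_x (pd_x (heat_u F)) (x, t) = - (- ?h 1 / (2 * t) - (2 * ?h 1 - ?h 3 / (2 * t)) / (2 * t)) / (2 * t)"
    by (subst pd_x_def) (simp add: 1)
  have inv: "((\<lambda>s. - (1 / (2 * s))) has_real_derivative 1 / (2 * t\<^sup>2)) (at t)"
    using t by (auto intro!: derivative_eq_intros simp: power2_eq_square field_simps)
  have "((\<lambda>s. - (1 / (2 * s)) * heat_moment F 1 s x) has_real_derivative
     1 / (2 * t\<^sup>2) * ?h 1 + (?h 3 / (4 * t\<^sup>2) - ?h 1 / (2 * t)) * - (1 / (2 * t))) (at t)"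
    using DERIV_mult[OF inv heat_moment_has_derivative_t[OF F t, of 1 x]] by (simp add: numeral_3_eq_3)
  from DERIV_imp_deriv[OF has_real_derivative_transform_pos[OF this t, of "\<lambda>s. heat_u F (x, s)"]]
  have "pd_t (heat_u F) (x, t) = 1 / (2 * t\<^sup>2) * ?h 1 + (?h 3 / (4 * t\<^sup>2) - ?h 1 / (2 * t)) * - (1 / (2 * t))"
    by (simp add: pd_t_def u)
  then show ?thesis unfolding 2 using t by (simp add: field_simps power2_eq_square)
qed

section \<open>Convergence to the initial data in the Alexiewicz norm\<close>

lemma Cbar_uniformly_continuous:
  assumes F: "F \<in> Cbar" and e: "e > 0"
  obtains d where "d > 0" "\<And>x y. \<bar>x - y\<bar> < d \<Longrightarrow> \<bar>F x - F y\<bar> < e"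
proof -
  obtain l m where cont: "continuous_on UNIV F" and lm: "(F \<longlongrightarrow> l) at_top" "(F \<longlongrightarrow> m) at_bot"
    using F by (auto simp: Cbar_def)
  have "eventually (\<lambda>x. dist (F x) l < e / 2) at_top" "eventually (\<lambda>x. dist (F x) m < e / 2) at_bot"
    using tendstoD[OF lm(1), of "e / 2"] tendstoD[OF lm(2), of "e / 2"] e by simp_all
  then obtain a b where a: "\<And>x. x \<ge> a \<Longrightarrow> dist (F x) l < e / 2" and b: "\<And>x. x \<le> b \<Longrightarrow> dist (F x) m < e / 2"
    by (auto simp: eventually_at_top_linorder eventually_at_bot_linorder)
  have "uniformly_continuous_on {b - 1..a + 1} F"
    by (intro compact_uniformly_continuous continuous_on_subset[OF cont]) auto
  then obtain d where d: "d > 0" "\<And>x y. x \<in> {b - 1..a + 1} \<Longrightarrow> y \<in> {b - 1..a + 1} \<Longrightarrow> dist y x < d \<Longrightarrow> dist (F y) (F x) < e"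
    using e unfolding uniformly_continuous_on_def by meson
  show ?thesis
  proof (rule that[of "min d 1"])
    show "min d 1 > 0" using d by simp
    fix x y :: real assume xy: "\<bar>x - y\<bar> < min d 1"
    \<comment> \<open>The compact interval overlaps each tail by length 1, and the points are less
      than 1 apart, so some region contains both.\<close>
    consider "x \<ge> a" "y \<ge> a" | "x \<le> b" "y \<le> b" | "x \<in> {b - 1..a + 1}" "y \<in> {b - 1..a + 1}"
      using xy by (auto simp: abs_less_iff) linarith
    then have "dist (F x) (F y) < e"
    proof cases
      case 1 then show ?thesis using dist_triangle_half_l[OF a[of x] a[of y]] by simp
    next
      case 2 then show ?thesis using dist_triangle_half_l[OF b[of x] b[of y]] by simp
    next
      case 3 then show ?thesis using d(2)[of y x] xy by (simp add: dist_norm)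
    qed
    then show "\<bar>F x - F y\<bar> < e" by (simp add: dist_norm)
  qed
qed

text \<open>For \<open>\<bar>y\<bar> \<ge> d\<close> the trivial bound \<open>2 * M\<close> is at
  most \<open>2 * M / d * \<bar>y\<bar>\<close>, so one affine majorant covers near and far.
  Integrating it costs a first absolute moment of order \<open>sqrt t\<close>, uniformly in
  \<open>x\<close>.\<close>

lemma heat_moment_0_error:
  assumes F: "F \<in> BC" and t: "t > 0" and M: "\<And>x. \<bar>F x\<bar> \<le> M"
    and d: "d > 0" "\<And>x y. \<bar>x - y\<bar> < d \<Longrightarrow> \<bar>F x - F y\<bar> < e"
  shows "\<bar>heat_moment F 0 t x - F x\<bar> \<le> e + 2 * M / d * (sqrt t * (2 / sqrt pi))"
proof -
  have e: "e > 0" using d(2)[of 0 0] d(1) by simp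
  have M0: "M \<ge> 0" using M[of 0] by linarith
  have int: "integrable lborel (\<lambda>w. F (x - sqrt t * w) * heat_kernel 1 w)" "integrable lborel (\<lambda>w. F x * heat_kernel 1 w)"
    using integrable_scaled_moment[OF F, of x "sqrt t" 0] integrable_heat_moment[of 0] by simp_all
  have bound: "\<bar>F (x - y) - F x\<bar> \<le> e + 2 * M / d * \<bar>y\<bar>" for y
  proof (cases "\<bar>y\<bar> < d")
    case True
    then have "\<bar>F (x - y) - F x\<bar> < e" by (intro d) simp
    moreover have "0 \<le> 2 * M / d * \<bar>y\<bar>" using M0 d by simp
    ultimately show ?thesis by linarith
  next
    case False
    have "\<bar>F (x - y) - F x\<bar> \<le> M + M" by (rule order_trans[OF abs_triangle_ineq4]) (intro add_mono M)
    also have "\<dots> = 2 * M * 1" by simp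
    also have "\<dots> \<le> 2 * M * (\<bar>y\<bar> / d)" using False d M0 by (intro mult_left_mono) auto
    finally show ?thesis using e by simp
  qed
  have "heat_moment F 0 t x - F x = (LINT w|lborel. F (x - sqrt t * w) * heat_kernel 1 w) - (LINT w|lborel. F x * heat_kernel 1 w)"
    by (simp add: heat_moment_0_scaled[OF F t] integral_heat_kernel)
  also have "\<dots> = (LINT w|lborel. (F (x - sqrt t * w) - F x) * heat_kernel 1 w)"
    unfolding left_diff_distrib Bochner_Integration.integral_diff[OF int] ..
  also have "\<bar>\<dots>\<bar> \<le> (LINT w|lborel. e * heat_kernel 1 w + 2 * M / d * sqrt t * (\<bar>w\<bar> * heat_kernel 1 w))"
  proof (rule integral_abs_bound_integral)
    show "integrable lborel (\<lambda>w. (F (x - sqrt t * w) - F x) * heat_kernel 1 w)"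
      unfolding left_diff_distrib by (intro Bochner_Integration.integrable_diff int)
    show "integrable lborel (\<lambda>w. e * heat_kernel 1 w + 2 * M / d * sqrt t * (\<bar>w\<bar> * heat_kernel 1 w))"
      using integrable_heat_moment[of 0] integrable_heat_moment_abs[of 1]
      by (intro Bochner_Integration.integrable_add integrable_mult_right) simp_all
    show "\<bar>(F (x - sqrt t * w) - F x) * heat_kernel 1 w\<bar> \<le> e * heat_kernel 1 w + 2 * M / d * sqrt t * (\<bar>w\<bar> * heat_kernel 1 w)" for w
    proof -
      have "\<bar>(F (x - sqrt t * w) - F x) * heat_kernel 1 w\<bar> = \<bar>F (x - sqrt t * w) - F x\<bar> * heat_kernel 1 w"
        by (simp add: abs_mult)
      also have "\<dots> \<le> (e + 2 * M / d * \<bar>sqrt t * w\<bar>) * heat_kernel 1 w"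
        by (intro mult_right_mono bound) simp
      also have "\<dots> = e * heat_kernel 1 w + 2 * M / d * sqrt t * (\<bar>w\<bar> * heat_kernel 1 w)"
        using t by (simp add: abs_mult algebra_simps)
      finally show ?thesis .
    qed
  qed
  also have "\<dots> = (LINT w|lborel. e * heat_kernel 1 w) + (LINT w|lborel. 2 * M / d * sqrt t * (\<bar>w\<bar> * heat_kernel 1 w))"
    using integrable_heat_moment[of 0] integrable_heat_moment_abs[of 1]
    by (intro Bochner_Integration.integral_add integrable_mult_right) simp_all
  also have "\<dots> = e + 2 * M / d * (sqrt t * (2 / sqrt pi))"
    unfolding Bochner_Integration.integral_mult_right_zero integral_heat_kernel integral_heat_moment_abs_1 by simp
  finally show ?thesis .
qed

lemma alex_heat_error_tendsto:
  assumes F: "F \<in> Bc"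
  shows "((\<lambda>t. alex (\<lambda>x. heat_moment F 0 t x - F x)) \<longlongrightarrow> 0) (at_right 0)"
proof (rule tendstoI)
  fix e :: real assume e: "e > 0"
  note B = Bc_imp_BC[OF F]
  obtain M where M: "\<And>x. \<bar>F x\<bar> \<le> M" using BC_bound[OF B] by blast
  \<comment> \<open>An increment involves two pointwise errors, so \<open>e / 4\<close> leaves the
    limiting bound \<open>e / 2\<close>.\<close>
  have "F \<in> Cbar" "e / 4 > 0" using F e by (auto simp: Bc_def)
  then obtain d where d: "d > 0" "\<And>x y. \<bar>x - y\<bar> < d \<Longrightarrow> \<bar>F x - F y\<bar> < e / 4"
    using Cbar_uniformly_continuous by metis
  have "((\<lambda>t. 2 * (e / 4 + 2 * M / d * (sqrt t * (2 / sqrt pi)))) \<longlongrightarrow> 2 * (e / 4 + 2 * M / d * (sqrt 0 * (2 / sqrt pi)))) (at_right 0)"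
    by (intro tendsto_intros)
  then have "eventually (\<lambda>t. 2 * (e / 4 + 2 * M / d * (sqrt t * (2 / sqrt pi))) < e) (at_right 0)"
    by (rule order_tendstoD) (use e in simp)
  moreover have "eventually (\<lambda>t. t > (0::real)) (at_right 0)" by (simp add: eventually_at_right_less)
  ultimately show "eventually (\<lambda>t. dist (alex (\<lambda>x. heat_moment F 0 t x - F x)) 0 < e) (at_right 0)"
  proof eventually_elim
    case (elim t)
    let ?H = "\<lambda>x. heat_moment F 0 t x - F x"
    have "(\<lambda>x. 1 * heat_moment F 0 t x + (- 1) * F x) \<in> BC"
      by (intro BC_linear B Bc_imp_BC[OF heat_moment_0_Bc[OF F]] elim)
    then have "?H \<in> BC" by simp
    then have "0 \<le> alex ?H" by (rule alex_nonneg)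
    moreover have "alex ?H \<le> 2 * (e / 4 + 2 * M / d * (sqrt t * (2 / sqrt pi)))"
    proof (rule alex_least)
      fix x y :: real
      note b = heat_moment_0_error[OF B elim(2) M d]
      show "\<bar>?H y - ?H x\<bar> \<le> 2 * (e / 4 + 2 * M / d * (sqrt t * (2 / sqrt pi)))"
        using order_trans[OF abs_triangle_ineq4 add_mono[OF b[of y] b[of x]]] by simp
    qed
    ultimately show ?case using elim by simp
  qed
qed

section \<open>A convolution outside every Lp space\<close>

text \<open>The decay is slower than every power, so no p-th power is integrable. The outer 1 keeps
  the denominator at least 1, also at the origin.\<close>

definition slow :: "real \<Rightarrow> real" where
  "slow x = 1 / (1 + ln (1 + \<bar>x\<bar>))"

lemma slow_pos: "slow x > 0"
  unfolding slow_def by (intro divide_pos_pos add_pos_nonneg) auto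

lemma slow_le_1: "slow x \<le> 1"
  unfolding slow_def by (subst divide_le_eq_1_pos) (auto intro: add_pos_nonneg)

lemma slow_mono: "0 \<le> x \<Longrightarrow> x \<le> y \<Longrightarrow> slow y \<le> slow x"
  unfolding slow_def by (intro divide_left_mono add_left_mono) (auto intro!: mult_pos_pos add_pos_nonneg)

lemma slow_tendsto: "(slow \<longlongrightarrow> 0) at_top" "(slow \<longlongrightarrow> 0) at_bot"
  unfolding slow_def[abs_def] by real_asymp+

lemma slow_continuous: "continuous_on UNIV slow"
proof -
  have "1 + ln (1 + \<bar>x\<bar>) > 0" "1 + \<bar>x\<bar> > 0" for x :: real
    by (auto intro!: add_pos_nonneg)
  then have "1 + ln (1 + \<bar>x\<bar>) \<noteq> 0" "1 + \<bar>x\<bar> \<noteq> 0" for x :: real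
    by (metis less_irrefl)+
  then show ?thesis unfolding slow_def[abs_def] by (intro continuous_intros) auto
qed

lemma slow_BC: "slow \<in> BC"
  using slow_continuous slow_le_1 slow_pos[THEN less_imp_le]
  by (auto simp: BC_def bounded_iff intro!: exI[of _ 1])

text \<open>The reciprocal of \<^term>\<open>slow\<close> is Lipschitz, hence a relative modulus of continuity.\<close>
lemma slow_diff_le: "\<bar>slow x - slow y\<bar> \<le> \<bar>x - y\<bar> * slow x * slow y"
proof -
  define B where "B z = 1 + ln (1 + \<bar>z\<bar>)" for z :: real
  have B: "B z \<ge> 1" "slow z = 1 / B z" for z by (simp_all add: B_def slow_def)
  have le: "B u - B v \<le> \<bar>u - v\<bar>" for u v
  proof -
    have "B u - B v \<le> ((1 + \<bar>u\<bar>) - (1 + \<bar>v\<bar>)) / (1 + \<bar>v\<bar>)"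
      unfolding B_def using ln_diff_le[of "1 + \<bar>u\<bar>" "1 + \<bar>v\<bar>"] by simp
    also have "\<dots> \<le> \<bar>u - v\<bar> / (1 + \<bar>v\<bar>)" by (intro divide_right_mono) auto
    also have "\<dots> \<le> \<bar>u - v\<bar> / 1" by (intro divide_left_mono) auto
    finally show ?thesis by simp
  qed
  have "\<bar>B y - B x\<bar> \<le> \<bar>x - y\<bar>" using le[of x y] le[of y x] by (simp add: abs_le_iff abs_minus_commute)
  then have "\<bar>B y - B x\<bar> * (slow x * slow y) \<le> \<bar>x - y\<bar> * (slow x * slow y)"
    by (intro mult_right_mono) (simp_all add: slow_pos less_imp_le)
  moreover have "slow x - slow y = (B y - B x) * (slow x * slow y)"
    using B(1)[of x] B(1)[of y] by (simp add: B(2) field_simps)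
  moreover have "0 \<le> slow x * slow y" by (simp add: slow_pos less_imp_le)
  ultimately show ?thesis by (simp add: abs_mult mult_ac abs_of_pos[OF slow_pos])
qed

section \<open>Gaussian averages of trigonometric functions\<close>

lemma integral_cos_std_normal: "(LINT x|lborel. std_normal_density x * cos (u * x)) = exp (- u\<^sup>2 / 2)"
proof -
  interpret real_distribution std_normal_distribution by (rule real_dist_normal_dist)
  have int: "integrable std_normal_distribution (\<lambda>x. iexp (u * x))"
    by (rule integrable_iexp) auto
  have "Re (char std_normal_distribution u) = (LINT x|std_normal_distribution. Re (iexp (u * x)))"
    unfolding char_def by (rule integral_Re[symmetric, OF int])
  also have "\<dots> = (LINT x|std_normal_distribution. cos (u * x))"
    by (simp add: Re_exp)
  also have "\<dots> = (LINT x|lborel. std_normal_density x * cos (u * x))"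
    by (subst integral_density) auto
  finally show ?thesis by (simp add: char_std_normal_distribution)
qed

lemma cos_BC: "cos \<in> BC"
  by (auto simp: BC_def bounded_iff intro!: exI[of _ 1] continuous_intros)

text \<open>At time 1 the kernel has variance 2; rescaling by \<open>sqrt 2\<close> to the standard
  normal turns \<open>s^2 / 2\<close> into \<open>s^2\<close>.\<close>

lemma integral_cos_heat: "(LINT w|lborel. cos (s * w) * heat_kernel 1 w) = exp (- s\<^sup>2)"
proof -
  have k: "sqrt 2 * heat_kernel 1 (sqrt 2 * v) = std_normal_density v" for v
    by (simp add: heat_kernel_def std_normal_density_def power_mult_distrib real_sqrt_mult real_sqrt_divide field_simps)
  have "(LINT w|lborel. cos (s * w) * heat_kernel 1 w) =
    \<bar>sqrt 2\<bar> *\<^sub>R (LINT v|lborel. cos (s * (0 + sqrt 2 * v)) * heat_kernel 1 (0 + sqrt 2 * v))"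
    by (rule lborel_integral_real_affine[of "sqrt 2" "\<lambda>w. cos (s * w) * heat_kernel 1 w" 0]) simp
  also have "\<dots> = (LINT v|lborel. (sqrt 2 * heat_kernel 1 (sqrt 2 * v)) * cos ((s * sqrt 2) * v))"
    by (simp add: mult_ac)
  also have "\<dots> = exp (- s\<^sup>2)" unfolding k integral_cos_std_normal by (simp add: power_mult_distrib)
  finally show ?thesis .
qed

lemma integral_sin_heat: "(LINT w|lborel. sin (s * w) * heat_kernel 1 w) = 0"
proof -
  let ?f = "\<lambda>w. sin (s * w) * heat_kernel 1 w"
  have "integral\<^sup>L lborel ?f = - integral\<^sup>L lborel ?f"
    using lborel_integral_real_affine[of "-1" ?f 0] by simp
  then show ?thesis by simp
qed

text \<open>The addition formula evaluates the smoothed primitive, the sine part vanishing by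
  oddness; its derivative must be the convolution.\<close>

lemma conv_heat_cos:
  assumes t: "t > 0" shows "conv_heat cos t x = - exp (- t) * sin x"
proof -
  have "heat_moment cos 0 t y = exp (- t) * cos y" for y
  proof -
    have "heat_moment cos 0 t y =
      (LINT w|lborel. cos y * (cos (sqrt t * w) * heat_kernel 1 w) + sin y * (sin (sqrt t * w) * heat_kernel 1 w))"
      unfolding heat_moment_0_scaled[OF cos_BC t] cos_diff distrib_right mult.assoc ..
    also have "\<dots> = cos y * (LINT w|lborel. cos (sqrt t * w) * heat_kernel 1 w) + sin y * (LINT w|lborel. sin (sqrt t * w) * heat_kernel 1 w)"
    proof (subst Bochner_Integration.integral_add)
      have "integrable lborel (\<lambda>w. cos (sqrt t * w) * heat_kernel 1 w)" "integrable lborel (\<lambda>w. sin (sqrt t * w) * heat_kernel 1 w)"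
        using integrable_heat_moment[of 0]
          integrable_bounded_mult[of "heat_kernel 1" "\<lambda>w. cos (sqrt t * w)" 1]
          integrable_bounded_mult[of "heat_kernel 1" "\<lambda>w. sin (sqrt t * w)" 1] by simp_all
      then show "integrable lborel (\<lambda>w. cos y * (cos (sqrt t * w) * heat_kernel 1 w))"
        "integrable lborel (\<lambda>w. sin y * (sin (sqrt t * w) * heat_kernel 1 w))" by simp_all
    qed simp
    finally show ?thesis using t by (simp add: integral_cos_heat integral_sin_heat)
  qed
  then have "heat_moment cos 0 t = (\<lambda>y. exp (- t) * cos y)" by (simp add: fun_eq_iff)
  with heat_moment_0_has_derivative[OF cos_BC t, of x]
  have "((\<lambda>y. exp (- t) * cos y) has_real_derivative conv_heat cos t x) (at x)" by simp
  moreover have "((\<lambda>y. exp (- t) * cos y) has_real_derivative - exp (- t) * sin x) (at x)"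
    by (auto intro!: derivative_eq_intros)
  ultimately show ?thesis by (rule DERIV_unique)
qed

text \<open>The heat semigroup maps \<open>cos\<close> to \<open>exp (- t) cos\<close>; the slowly varying amplitude perturbs this only
  by lower order terms.\<close>
definition osc :: "real \<Rightarrow> real" where "osc x = slow x * cos x"

lemma osc_Bc: "osc \<in> Bc"
proof -
  have le: "\<bar>osc x\<bar> \<le> slow x" for x
    using slow_pos[of x] by (simp add: osc_def abs_mult mult_left_le)
  have "(osc \<longlongrightarrow> 0) at_top" "(osc \<longlongrightarrow> 0) at_bot"
    using slow_tendsto by (auto intro!: Lim_null_comparison[of osc slow] always_eventually simp: le)
  moreover have "continuous_on UNIV osc"
    unfolding osc_def[abs_def] by (intro continuous_intros slow_continuous)
  ultimately show ?thesis by (auto simp: Bc_def Cbar_def)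
qed

text \<open>Freezing the amplitude at \<open>x\<close> costs at most
  \<open>sqrt t * \<bar>w\<bar> * slow x * slow (x - sqrt t * w)\<close>. Keeping the last factor
  under the integral makes the error small relative to \<open>slow x\<close>, since that integral
  tends to 0 at infinity.\<close>

lemma conv_heat_osc_error:
  assumes t: "t > 0"
  shows "\<bar>conv_heat osc t x - slow x * conv_heat cos t x\<bar> \<le>
    slow x * (1 / 2 * (LINT w|lborel. slow (x - sqrt t * w) * (w ^ 2 * heat_kernel 1 w)))"
proof -
  note B = Bc_imp_BC[OF osc_Bc]
  let ?a = "\<lambda>w. slow (x - sqrt t * w)" and ?c = "\<lambda>w. cos (x - sqrt t * w)"
  have i1: "integrable lborel (\<lambda>w. osc (x - sqrt t * w) * (w * heat_kernel 1 w))"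
    using integrable_scaled_moment[OF B, of x "sqrt t" 1] by simp
  have i2: "integrable lborel (\<lambda>w. slow x * (?c w * (w * heat_kernel 1 w)))"
    using integrable_scaled_moment[OF cos_BC, of x "sqrt t" 1] by simp
  have eq: "osc (x - sqrt t * w) * (w * heat_kernel 1 w) - slow x * (?c w * (w * heat_kernel 1 w)) =
     (?a w - slow x) * ?c w * (w * heat_kernel 1 w)" for w
    by (simp add: osc_def algebra_simps)
  define I1 where "I1 = (LINT w|lborel. osc (x - sqrt t * w) * (w * heat_kernel 1 w))"
  define I2 where "I2 = (LINT w|lborel. ?c w * (w * heat_kernel 1 w))"
  define I3 where "I3 = (LINT w|lborel. ?a w * (w ^ 2 * heat_kernel 1 w))"
  have "I1 - slow x * I2 = (LINT w|lborel. osc (x - sqrt t * w) * (w * heat_kernel 1 w) - slow x * (?c w * (w * heat_kernel 1 w)))"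
    unfolding Bochner_Integration.integral_diff[OF i1 i2] Bochner_Integration.integral_mult_right_zero I1_def I2_def ..
  then have diff: "I1 - slow x * I2 = (LINT w|lborel. (?a w - slow x) * ?c w * (w * heat_kernel 1 w))"
    unfolding eq .
  have bound: "\<bar>I1 - slow x * I2\<bar> \<le> (LINT w|lborel. sqrt t * slow x * (?a w * (w ^ 2 * heat_kernel 1 w)))"
    unfolding diff
  proof (rule integral_abs_bound_integral)
    show "integrable lborel (\<lambda>w. (?a w - slow x) * ?c w * (w * heat_kernel 1 w))"
      unfolding eq[symmetric] by (rule Bochner_Integration.integrable_diff[OF i1 i2])
    show "integrable lborel (\<lambda>w. sqrt t * slow x * (?a w * (w ^ 2 * heat_kernel 1 w)))"
      by (rule integrable_mult_right[OF integrable_scaled_moment[OF slow_BC, of x "sqrt t" 2]])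
    fix w
    have "\<bar>?a w - slow x\<bar> * \<bar>?c w\<bar> \<le> (sqrt t * \<bar>w\<bar> * ?a w * slow x) * 1"
      using slow_diff_le[of "x - sqrt t * w" x] t by (intro mult_mono) (auto simp: abs_mult)
    then have "\<bar>?a w - slow x\<bar> * \<bar>?c w\<bar> * (\<bar>w\<bar> * heat_kernel 1 w) \<le> sqrt t * \<bar>w\<bar> * ?a w * slow x * 1 * (\<bar>w\<bar> * heat_kernel 1 w)"
      by (intro mult_right_mono) auto
    also have "\<dots> = sqrt t * slow x * (?a w * ((\<bar>w\<bar> * \<bar>w\<bar>) * heat_kernel 1 w))" by (simp only: mult_ac mult_1_right)
    finally show "\<bar>(?a w - slow x) * ?c w * (w * heat_kernel 1 w)\<bar> \<le> sqrt t * slow x * (?a w * (w ^ 2 * heat_kernel 1 w))"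
      by (simp add: abs_mult power2_eq_square)
  qed
  have bound: "\<bar>I1 - slow x * I2\<bar> \<le> sqrt t * slow x * I3"
    using bound unfolding I3_def Bochner_Integration.integral_mult_right_zero .
  have "conv_heat osc t x - slow x * conv_heat cos t x = - (I1 - slow x * I2) / (2 * sqrt t)"
    unfolding conv_heat_scaled[OF B t] conv_heat_scaled[OF cos_BC t] I1_def[symmetric] I2_def[symmetric]
    by (simp add: diff_divide_distrib)
  then have "\<bar>conv_heat osc t x - slow x * conv_heat cos t x\<bar> = \<bar>I1 - slow x * I2\<bar> / (2 * sqrt t)"
    using t by (simp add: abs_mult)
  also have "\<dots> \<le> sqrt t * slow x * I3 / (2 * sqrt t)"
    by (rule divide_right_mono[OF bound]) (use t in simp)
  also have "\<dots> = slow x * (1 / 2 * I3)" using t by simp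
  finally show ?thesis unfolding I3_def .
qed

lemma conv_heat_osc_lower:
  assumes t: "t > 0"
  shows "eventually (\<lambda>x. slow x * exp (- t) * (\<bar>sin x\<bar> - 1 / 4) \<le> \<bar>conv_heat osc t x\<bar>) at_top"
proof -
  define h where "h x = (LINT w|lborel. slow (x - sqrt t * w) * (w ^ 2 * heat_kernel 1 w))" for x
  have "(h \<longlongrightarrow> 0) at_top"
    using scaled_moment_tendsto_at_top[OF slow_BC slow_tendsto(1), of "sqrt t" 2]
    unfolding h_def[abs_def] mult_zero_left .
  \<comment> \<open>With the factor \<open>1 / 2\<close> of the error bound this gives the
    \<open>1 / 4\<close> in the claim.\<close>
  then have "eventually (\<lambda>x. h x < exp (- t) / 2) at_top"
    by (rule order_tendstoD) simp
  then show ?thesis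
  proof eventually_elim
    case (elim x)
    have "\<bar>conv_heat osc t x - slow x * conv_heat cos t x\<bar> \<le> slow x * (exp (- t) / 4)"
      by (rule order_trans[OF conv_heat_osc_error[OF t, folded h_def] mult_left_mono])
         (use elim slow_pos[of x] in auto)
    moreover have "\<bar>slow x * conv_heat cos t x\<bar> = slow x * exp (- t) * \<bar>sin x\<bar>"
      using slow_pos[of x] by (simp add: conv_heat_cos[OF t] abs_mult)
    moreover have "\<bar>slow x * conv_heat cos t x\<bar> - \<bar>conv_heat osc t x - slow x * conv_heat cos t x\<bar> \<le> \<bar>conv_heat osc t x\<bar>"
      using abs_triangle_ineq2[of "slow x * conv_heat cos t x" "slow x * conv_heat cos t x - conv_heat osc t x"]
      by (simp add: abs_minus_commute)
    ultimately have "slow x * exp (- t) * \<bar>sin x\<bar> - slow x * (exp (- t) / 4) \<le> \<bar>conv_heat osc t x\<bar>" by linarith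
    then show ?case by (simp add: algebra_simps)
  qed
qed

lemma conv_heat_continuous:
  assumes F: "F \<in> BC" and t: "t > 0" shows "continuous_on UNIV (conv_heat F t)"
proof -
  have "continuous_on UNIV (\<lambda>x. - heat_moment F 1 t x / (2 * t))"
    using t by (intro continuous_intros continuous_at_imp_continuous_on ballI DERIV_isCont[OF heat_moment_has_derivative_x[OF F]]) auto
  then show ?thesis by (simp add: conv_heat_eq[OF F t, abs_def])
qed

lemma real_analytic_on_cmult:
  assumes "real_analytic_on S f" shows "real_analytic_on S (\<lambda>x. c * f x)"
  unfolding real_analytic_on_def
proof
  fix x assume "x \<in> S"
  then obtain r a where r: "r > 0" "\<And>y. \<bar>y - x\<bar> < r \<Longrightarrow> (\<lambda>n. a n * (y - x) ^ n) sums f y"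
    using assms unfolding real_analytic_on_def by meson
  then have "(\<lambda>n. (c * a n) * (y - x) ^ n) sums (c * f y)" if "\<bar>y - x\<bar> < r" for y
    using sums_mult[OF r(2)[OF that], of c] by (simp add: mult.assoc)
  with r(1) show "\<exists>r>0. \<exists>a. \<forall>y. \<bar>y - x\<bar> < r \<longrightarrow> (\<lambda>n. a n * (y - x) ^ n) sums (c * f y)"
    by (intro exI[of _ r] conjI exI[of _ "\<lambda>n. c * a n"]) auto
qed

lemma real_analytic_conv_heat:
  assumes F: "F \<in> BC"
  shows "t > 0 \<Longrightarrow> real_analytic_on UNIV (conv_heat F t)"
    and "real_analytic_on {0<..} (\<lambda>s. conv_heat F s x)"
proof -
  show "real_analytic_on UNIV (conv_heat F t)" if t: "t > 0"
    using real_analytic_on_cmult[OF real_analytic_heat_moment_x[OF F t, of 1], of "- 1 / (2 * t)"]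
    by (simp add: conv_heat_eq[OF F t, abs_def])
  show "real_analytic_on {0<..} (\<lambda>s. conv_heat F s x)"
  proof (rule real_analytic_heat_moment_t[OF F])
    show "conv_heat F t x = - 1 / 2 * t powi (- 1) * heat_moment F 1 t x" if "t > 0" for t
      using that by (simp add: conv_heat_eq[OF F that] power_int_minus field_simps)
  qed
qed

text \<open>The zeros of the sine are avoided by pairing \<open>x\<close> with
  \<open>x + pi / 2\<close>: the sine is at least \<open>1 / 2\<close> in modulus at one of the two.
  The sum of both p-th powers then dominates \<open>1 / x\<close> far out, and by translation
  invariance its integral is twice the one in question.\<close>

lemma conv_heat_osc_not_Lp:
  assumes t: "t > 0" and p: "1 \<le> (p::real)"
  shows "(\<integral>\<^sup>+ x. ennreal (\<bar>conv_heat osc t x\<bar> powr p) \<partial>lborel) = \<infinity>"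
proof -
  note [measurable] = borel_measurable_continuous_onI[OF conv_heat_continuous[OF Bc_imp_BC[OF osc_Bc] t]]
  define u where "u = conv_heat osc t"
  have [measurable]: "u \<in> borel_measurable borel" unfolding u_def by measurable
  \<comment> \<open>This is \<open>exp (- t) * (1 / 2 - 1 / 4)\<close>, what the lower bound leaves
    when the sine is at least \<open>1 / 2\<close> in modulus.\<close>
  define q where "q = exp (- t) / 4"
  have q: "q > 0" by (simp add: q_def)
  let ?K = "\<integral>\<^sup>+ x. ennreal (\<bar>u x\<bar> powr p) \<partial>lborel"
  obtain X where X: "\<And>x. x \<ge> X \<Longrightarrow> slow x * exp (- t) * (\<bar>sin x\<bar> - 1 / 4) \<le> \<bar>u x\<bar>"
    using conv_heat_osc_lower[OF t] unfolding u_def eventually_at_top_linorder by blast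
  \<comment> \<open>Any power of a logarithm is eventually below \<open>x\<close>. The amplitude is
    taken at \<open>x + pi / 2\<close>, the smaller of its two values, so the bound serves both
    alternatives.\<close>
  have "eventually (\<lambda>x::real. 1 / x \<le> (q / (1 + ln (1 + \<bar>x + pi / 2\<bar>))) powr p) at_top"
    using q p by real_asymp
  then obtain X' where X': "\<And>x. x \<ge> X' \<Longrightarrow> 1 / x \<le> (q / (1 + ln (1 + \<bar>x + pi / 2\<bar>))) powr p"
    unfolding eventually_at_top_linorder by blast
  define Y where "Y = max 1 (max X X')"
  have lower: "1 / x \<le> \<bar>u x\<bar> powr p + \<bar>u (x + pi / 2)\<bar> powr p" if x: "x \<ge> Y" for x
  proof -
    have xs: "x \<ge> X" "x + pi / 2 \<ge> X" "x \<ge> X'" "x \<ge> 0" "x \<le> x + pi / 2"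
      using x pi_gt_zero by (auto simp: Y_def intro: add_increasing2)
    have big: "slow y * q \<le> \<bar>u y\<bar>" if "y \<ge> X" "\<bar>sin y\<bar> \<ge> 1 / 2" for y
    proof -
      have "slow y * exp (- t) * (1 / 4) \<le> slow y * exp (- t) * (\<bar>sin y\<bar> - 1 / 4)"
        using that slow_pos[of y] by (intro mult_left_mono) auto
      with X[OF that(1)] show ?thesis by (simp add: q_def)
    qed
    have "\<bar>sin x\<bar> \<ge> 1 / 2 \<or> \<bar>cos x\<bar> \<ge> 1 / 2"
    proof (rule ccontr)
      assume "\<not> ?thesis"
      then have "\<bar>sin x\<bar> \<le> 1 / 2" "\<bar>cos x\<bar> \<le> 1 / 2" by auto
      then have "\<bar>sin x\<bar>\<^sup>2 \<le> (1 / 2)\<^sup>2" "\<bar>cos x\<bar>\<^sup>2 \<le> (1 / 2)\<^sup>2"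
        by (simp_all only: power_mono abs_ge_zero)
      then have "(sin x)\<^sup>2 + (cos x)\<^sup>2 \<le> 1 / 4 + 1 / 4" unfolding power2_abs by (simp add: power2_eq_square)
      then show False by simp
    qed
    then have "slow (x + pi / 2) * q \<le> \<bar>u x\<bar> \<or> slow (x + pi / 2) * q \<le> \<bar>u (x + pi / 2)\<bar>"
    proof
      assume "\<bar>sin x\<bar> \<ge> 1 / 2"
      then have "slow x * q \<le> \<bar>u x\<bar>" by (rule big[OF xs(1)])
      moreover have "slow (x + pi / 2) * q \<le> slow x * q"
        using q slow_mono[OF xs(4,5)] by (intro mult_right_mono) auto
      ultimately show ?thesis by linarith
    next
      assume "\<bar>cos x\<bar> \<ge> 1 / 2"
      then have "\<bar>sin (x + pi / 2)\<bar> \<ge> 1 / 2" by (simp add: sin_add)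
      from big[OF xs(2) this] show ?thesis ..
    qed
    then have "(slow (x + pi / 2) * q) powr p \<le> \<bar>u x\<bar> powr p \<or> (slow (x + pi / 2) * q) powr p \<le> \<bar>u (x + pi / 2)\<bar> powr p"
      using p q slow_pos[of "x + pi / 2"] by (auto intro!: powr_mono2)
    moreover have "1 / x \<le> (slow (x + pi / 2) * q) powr p" using X'[OF xs(3)] by (simp add: slow_def)
    moreover have "0 \<le> \<bar>u x\<bar> powr p" "0 \<le> \<bar>u (x + pi / 2)\<bar> powr p" by simp_all
    ultimately show ?thesis by linarith
  qed
  have shift: "(\<integral>\<^sup>+ x. ennreal (\<bar>u (x + pi / 2)\<bar> powr p) \<partial>lborel) = ?K"
    using nn_integral_real_affine[of "\<lambda>x. ennreal (\<bar>u x\<bar> powr p)" 1 "pi / 2"] by (simp add: add.commute)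
  have "ennreal (real n) \<le> ?K + ?K" for n
  proof -
    \<comment> \<open>The endpoint for which the integral of \<open>1 / x\<close> over
      \<open>{Y..Z}\<close> is exactly \<open>n\<close>.\<close>
    define Z where "Z = Y * exp (real n)"
    have Y: "Y > 0" by (simp add: Y_def)
    have YZ: "Y \<le> Z" unfolding Z_def using Y by simp
    have "(\<integral>\<^sup>+ x. ennreal (1 / x) * indicator {Y..Z} x \<partial>lborel) = ennreal (ln Z - ln Y)"
    proof (rule nn_integral_FTC_Icc[OF _ _ _ YZ])
      show "(ln has_real_derivative 1 / x) (at x)" if "x \<in> {Y..Z}" for x
        using that Y by (auto intro!: derivative_eq_intros)
    qed (use Y in auto)
    also have "ln Z - ln Y = real n" using Y by (simp add: Z_def ln_mult)
    finally have "ennreal (real n) = (\<integral>\<^sup>+ x. ennreal (1 / x) * indicator {Y..Z} x \<partial>lborel)" ..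
    also have "\<dots> \<le> (\<integral>\<^sup>+ x. ennreal (\<bar>u x\<bar> powr p) + ennreal (\<bar>u (x + pi / 2)\<bar> powr p) \<partial>lborel)"
      by (intro nn_integral_mono) (auto simp: indicator_def lower ennreal_leI simp flip: ennreal_plus)
    also have "\<dots> = ?K + ?K" by (subst nn_integral_add) (auto simp: shift)
    finally show ?thesis .
  qed
  then have ge: "of_nat n \<le> ?K + ?K" for n
    by (simp add: ennreal_of_nat_eq_real_of_nat)
  have "?K + ?K = top"
  proof (rule ccontr)
    assume "?K + ?K \<noteq> top"
    then have "?K + ?K < top" by (simp only: less_top)
    then obtain n where "?K + ?K < of_nat n" using ennreal_Ex_less_of_nat by blast
    with ge[of n] show False by (rule leD[THEN notE])
  qed
  then show ?thesis unfolding u_def by simp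
qed

theorem theorem3p1:
  fixes F :: "real \<Rightarrow> real"
  assumes F: "F \<in> Bc"
  shows
  \<comment> \<open>(a)\<close>
  "(\<forall>x. \<forall>t>0.
      hs_integrable_R F (\<lambda>\<xi>. heat_kernel t (x - \<xi>)) \<and>
      hs_integrable_R (refl_prim F x) (heat_kernel t) \<and>
      (\<lambda>\<xi>. F \<xi> * deriv (heat_kernel t) (x - \<xi>)) integrable_on UNIV \<and>
      (\<lambda>\<xi>. F \<xi> * heat_kernel t (x - \<xi>)) integrable_on UNIV \<and>
      conv_heat F t x = heat_conv F t x \<and>
      heat_conv F t x = integral UNIV (\<lambda>\<xi>. F \<xi> * deriv (heat_kernel t) (x - \<xi>)) \<and>
      ((\<lambda>y. integral UNIV (\<lambda>\<xi>. F \<xi> * heat_kernel t (y - \<xi>)))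
         has_real_derivative conv_heat F t x) (at x))
   \<and>
  \<comment> \<open>(b)\<close>
   C_infinity_on (UNIV \<times> {0<..}) (heat_u F)
   \<and>
  \<comment> \<open>(c)\<close>
   (\<forall>t>0. sup_norm (conv_heat F t) \<le> alex F / (2 * sqrt (pi * t)) \<and>
      (\<forall>c < 1 / (2 * sqrt (pi * t)). \<exists>G\<in>Bc. sup_norm (conv_heat G t) > c * alex G))
   \<and>
  \<comment> \<open>(d)\<close>
   (\<forall>t>0. (\<forall>G\<in>Bc. conv_heat G t \<in> Cbar) \<and>
      (\<forall>G\<in>Bc. \<forall>H\<in>Bc. \<forall>a b. conv_heat (\<lambda>x. a * G x + b * H x) t =
          (\<lambda>x. a * conv_heat G t x + b * conv_heat H t x)) \<and>
      Sup {sup_norm (conv_heat G t) | G. G \<in> Bc \<and> alex G \<le> 1} = 1 / (2 * sqrt (pi * t)))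
   \<and>
  \<comment> \<open>(e)\<close>
   (\<forall>t>0. (conv_heat F t \<longlongrightarrow> 0) at_infinity)
   \<and>
  \<comment> \<open>(f)\<close>
   (\<forall>t>0. fun_in_Ac (conv_heat F t) \<and>
      alex (Ac_prim (conv_heat F t)) \<le> alex F \<and>
      (\<forall>c < 1. \<exists>G\<in>Bc. alex (Ac_prim (conv_heat G t)) > c * alex G) \<and>
      (\<forall>G\<in>Bc. fun_in_Ac (conv_heat G t)) \<and>
      Sup {alex (Ac_prim (conv_heat G t)) | G. G \<in> Bc \<and> alex G \<le> 1} = 1)
   \<and>
  \<comment> \<open>(g)\<close>
   (continuous_on (UNIV \<times> {0<..}) (heat_u F) \<and>
    continuous_on (UNIV \<times> {0<..}) (pd_x (heat_u F)) \<and>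
    continuous_on (UNIV \<times> {0<..}) (pd_x (pd_x (heat_u F))) \<and>
    continuous_on (UNIV \<times> {0<..}) (pd_t (heat_u F)) \<and>
    (\<forall>x. \<forall>t>0.
       (\<lambda>y. heat_u F (y, t)) differentiable (at x) \<and>
       (\<lambda>y. pd_x (heat_u F) (y, t)) differentiable (at x) \<and>
       (\<lambda>s. heat_u F (x, s)) differentiable (at t) \<and>
       pd_t (heat_u F) (x, t) - pd_x (pd_x (heat_u F)) (x, t) = 0) \<and>
    ((\<lambda>t. alex (\<lambda>x. Ac_prim (conv_heat F t) x - F x)) \<longlongrightarrow> 0) (at_right 0))
   \<and>
  \<comment> \<open>(h)\<close>
   (\<forall>t>0. cp_integral_R (Ac_prim (conv_heat F t)) = cp_integral_R F)
   \<and>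
  \<comment> \<open>(i)\<close>
   (\<forall>t>0. \<exists>G\<in>Bc. \<forall>p::real. 1 \<le> p \<longrightarrow>
      (\<integral>\<^sup>+ x. ennreal (\<bar>conv_heat G t x\<bar> powr p) \<partial>lborel) = \<infinity>)
   \<and>
  \<comment> \<open>(j)\<close>
   (\<forall>t>0. real_analytic_on UNIV (conv_heat F t) \<and>
      (\<forall>x. real_analytic_on {0<..} (\<lambda>s. conv_heat F s x)))"
proof (intro conjI)
  note B = Bc_imp_BC[OF F]
  show "\<forall>x. \<forall>t>0. hs_integrable_R F (\<lambda>\<xi>. heat_kernel t (x - \<xi>)) \<and>
      hs_integrable_R (refl_prim F x) (heat_kernel t) \<and>
      (\<lambda>\<xi>. F \<xi> * deriv (heat_kernel t) (x - \<xi>)) integrable_on UNIV \<and>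
      (\<lambda>\<xi>. F \<xi> * heat_kernel t (x - \<xi>)) integrable_on UNIV \<and>
      conv_heat F t x = heat_conv F t x \<and>
      heat_conv F t x = integral UNIV (\<lambda>\<xi>. F \<xi> * deriv (heat_kernel t) (x - \<xi>)) \<and>
      ((\<lambda>y. integral UNIV (\<lambda>\<xi>. F \<xi> * heat_kernel t (y - \<xi>)))
         has_real_derivative conv_heat F t x) (at x)"
    using conv_heat_representations[OF B] by blast
  note smooth = C_infinity_heat_u[OF B]
  show "C_infinity_on (UNIV \<times> {0<..}) (heat_u F)" by (rule smooth)
  have sup: "sup_norm (conv_heat G t) \<le> alex G / (2 * sqrt (pi * t))" if "G \<in> Bc" "t > 0" for G t
    by (rule sup_norm_least, rule conv_heat_bound[OF Bc_imp_BC[OF that(1)] that(2)])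
  show "\<forall>t>0. sup_norm (conv_heat F t) \<le> alex F / (2 * sqrt (pi * t)) \<and>
      (\<forall>c < 1 / (2 * sqrt (pi * t)). \<exists>G\<in>Bc. sup_norm (conv_heat G t) > c * alex G)"
  proof (intro allI impI conjI sup F)
    fix t c :: real assume "t > 0" "c < 1 / (2 * sqrt (pi * t))"
    from conv_heat_sharp[OF this] show "\<exists>G\<in>Bc. sup_norm (conv_heat G t) > c * alex G"
      by (auto intro!: bexI)
  qed
  show "\<forall>t>0. (\<forall>G\<in>Bc. conv_heat G t \<in> Cbar) \<and>
      (\<forall>G\<in>Bc. \<forall>H\<in>Bc. \<forall>a b. conv_heat (\<lambda>x. a * G x + b * H x) t =
          (\<lambda>x. a * conv_heat G t x + b * conv_heat H t x)) \<and>
      Sup {sup_norm (conv_heat G t) | G. G \<in> Bc \<and> alex G \<le> 1} = 1 / (2 * sqrt (pi * t))"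
  proof (intro allI impI conjI ballI)
    fix t :: real assume t: "t > 0"
    show "conv_heat G t \<in> Cbar" if "G \<in> Bc" for G
      using conv_heat_tendsto[OF that t] conv_heat_continuous[OF Bc_imp_BC[OF that] t]
      by (auto simp: Cbar_def)
    show "conv_heat (\<lambda>x. a * G x + b * H x) t = (\<lambda>x. a * conv_heat G t x + b * conv_heat H t x)"
      if "G \<in> Bc" "H \<in> Bc" for G H a b
      by (intro conv_heat_linear Bc_imp_BC that t)
    let ?k = "1 / (2 * sqrt (pi * t))"
    \<comment> \<open>The ramps only approach the constant, so the least upper bound property is
      verified.\<close>
    show "Sup {sup_norm (conv_heat G t) | G. G \<in> Bc \<and> alex G \<le> 1} = ?k"
    proof (rule cSup_eq_non_empty)
      show "{sup_norm (conv_heat G t) | G. G \<in> Bc \<and> alex G \<le> 1} \<noteq> {}"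
        using ramp_props[of 1] by force
      fix y assume "y \<in> {sup_norm (conv_heat G t) | G. G \<in> Bc \<and> alex G \<le> 1}"
      then obtain G where G: "y = sup_norm (conv_heat G t)" "G \<in> Bc" "alex G \<le> 1" by blast
      have "y \<le> alex G / (2 * sqrt (pi * t))" unfolding G(1) by (rule sup[OF G(2) t])
      also have "\<dots> \<le> ?k" using G(3) t by (intro divide_right_mono) auto
      finally show "y \<le> ?k" .
    next
      fix y assume y: "\<And>z. z \<in> {sup_norm (conv_heat G t) | G. G \<in> Bc \<and> alex G \<le> 1} \<Longrightarrow> z \<le> y"
      show "?k \<le> y"
      proof (rule ccontr)
        assume "\<not> ?k \<le> y"
        then obtain G where "G \<in> Bc" "alex G = 1" "y < sup_norm (conv_heat G t)"
          using conv_heat_sharp[OF t, of y] by auto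
        with y[of "sup_norm (conv_heat G t)"] show False by force
      qed
    qed
  qed
  show "\<forall>t>0. (conv_heat F t \<longlongrightarrow> 0) at_infinity" using conv_heat_tendsto(3)[OF F] by blast
  have inAc: "fun_in_Ac (conv_heat G t)" if "G \<in> Bc" "t > 0" for G t
    unfolding fun_in_Ac_def using is_prim_of_conv_heat[OF that] by blast
  have alex: "alex (Ac_prim (conv_heat G t)) \<le> alex G" if "G \<in> Bc" "t > 0" for G t
    unfolding Ac_prim_conv_heat[OF that] by (rule alex_heat_moment_0[OF Bc_imp_BC[OF that(1)] that(2)])
  note r = ramp_props[of 1, simplified]
  show "\<forall>t>0. fun_in_Ac (conv_heat F t) \<and>
      alex (Ac_prim (conv_heat F t)) \<le> alex F \<and>
      (\<forall>c < 1. \<exists>G\<in>Bc. alex (Ac_prim (conv_heat G t)) > c * alex G) \<and>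
      (\<forall>G\<in>Bc. fun_in_Ac (conv_heat G t)) \<and>
      Sup {alex (Ac_prim (conv_heat G t)) | G. G \<in> Bc \<and> alex G \<le> 1} = 1"
  proof (intro allI impI conjI ballI inAc alex F)
    fix t :: real assume t: "t > 0"
    have 1: "alex (Ac_prim (conv_heat (ramp 1) t)) = 1"
      unfolding Ac_prim_conv_heat[OF r(1) t] by (rule alex_smoothed_ramp[OF t])
    show "\<exists>G\<in>Bc. alex (Ac_prim (conv_heat G t)) > c * alex G" if "c < 1" for c
      by (rule bexI[OF _ r(1)]) (simp add: 1 r(3) that)
    \<comment> \<open>Here the supremum is a maximum, attained at \<open>ramp 1\<close>.\<close>
    show "Sup {alex (Ac_prim (conv_heat G t)) | G. G \<in> Bc \<and> alex G \<le> 1} = 1"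
    proof (rule cSup_eq_maximum)
      show "1 \<in> {alex (Ac_prim (conv_heat G t)) | G. G \<in> Bc \<and> alex G \<le> 1}"
        using 1 r by force
      show "y \<le> 1" if "y \<in> {alex (Ac_prim (conv_heat G t)) | G. G \<in> Bc \<and> alex G \<le> 1}" for y
        using that alex[OF _ t] by fastforce
    qed
  qed
  note cont = smooth[unfolded C_infinity_on_def, rule_format, THEN conjunct1]
  show "continuous_on (UNIV \<times> {0<..}) (heat_u F)" using cont[of "[]"] by simp
  show "continuous_on (UNIV \<times> {0<..}) (pd_x (heat_u F))" using cont[of "[True]"] by simp
  show "continuous_on (UNIV \<times> {0<..}) (pd_x (pd_x (heat_u F)))" using cont[of "[True, True]"] by simp
  show "continuous_on (UNIV \<times> {0<..}) (pd_t (heat_u F))" using cont[of "[False]"] by simp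
  have diff: "(\<lambda>y. iter_pd bs (heat_u F) (y, t)) differentiable (at x)"
    "(\<lambda>s. iter_pd bs (heat_u F) (x, s)) differentiable (at t)" if "t > 0" for bs x t
    using smooth that unfolding C_infinity_on_def by auto
  show "\<forall>x. \<forall>t>0. (\<lambda>y. heat_u F (y, t)) differentiable (at x) \<and>
       (\<lambda>y. pd_x (heat_u F) (y, t)) differentiable (at x) \<and>
       (\<lambda>s. heat_u F (x, s)) differentiable (at t) \<and>
       pd_t (heat_u F) (x, t) - pd_x (pd_x (heat_u F)) (x, t) = 0"
    using diff[of _ "[]"] diff(1)[of _ "[True]"] heat_equation[OF B] by simp
  have "eventually (\<lambda>t. alex (\<lambda>x. heat_moment F 0 t x - F x) = alex (\<lambda>x. Ac_prim (conv_heat F t) x - F x)) (at_right 0)"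
    using eventually_at_right_less[of 0] by eventually_elim (simp add: Ac_prim_conv_heat[OF F])
  with alex_heat_error_tendsto[OF F]
  show "((\<lambda>t. alex (\<lambda>x. Ac_prim (conv_heat F t) x - F x)) \<longlongrightarrow> 0) (at_right 0)"
    by (rule Lim_transform_eventually)
  show "\<forall>t>0. cp_integral_R (Ac_prim (conv_heat F t)) = cp_integral_R F"
    using at_pinf_eq[OF heat_moment_0_tendsto(1)[OF F]] at_minf_eq[OF heat_moment_0_tendsto(2)[OF F]]
    by (simp add: cp_integral_R_def Ac_prim_conv_heat[OF F] at_minf_eq[OF Bc_tendsto(2)[OF F]])
  show "\<forall>t>0. \<exists>G\<in>Bc. \<forall>p::real. 1 \<le> p \<longrightarrow>
      (\<integral>\<^sup>+ x. ennreal (\<bar>conv_heat G t x\<bar> powr p) \<partial>lborel) = \<infinity>"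
    using osc_Bc conv_heat_osc_not_Lp by blast
  show "\<forall>t>0. real_analytic_on UNIV (conv_heat F t) \<and> (\<forall>x. real_analytic_on {0<..} (\<lambda>s. conv_heat F s x))"
    using real_analytic_conv_heat[OF B] by blast
qed

end
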